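(* Assume that the numerical solutions $\mathbf U_h^C,\mathbf U_h^D$ satisfy $$\mathbf U_h^C(x,y)\in G\ \ \forall(x,y)\in\mathbb S_{ij},\qquad \mathbf U_h^D(x,y)\in G\ \ \forall(x,y)\in\mathbb S_{i+\frac12,j+\frac12},\qquad\forall i,j,$$ and that the projected stationary hydrostatic solutions satisfy $$\mathbf U_h^{s,C}(x,y)\in G\ \ \forall(x,y)\in\mathbb S_{ij},\qquad \mathbf U_h^{s,D}(x,y)\in G\ \ \forall(x,y)\in\mathbb S_{i+\frac12,j+\frac12},\qquad\forall i,j.$$ If $\overline{\mathbf U}_{ij}^C,\overline{\mathbf U}_{i+\frac12,j+\frac12}^D\in G$ for all $i,j$, then $$\overline{\mathbf U}_{ij}^C+\Delta t\,\mathbf L_{ij}^C(\mathbf U_h^C,\mathbf U_h^D)\in G,\qquad \overline{\mathbf U}_{i+\frac12,j+\frac12}^D+\Delta t\,\mathbf L_{i+\frac12,j+\frac12}^D(\mathbf U_h^D,\mathbf U_h^C)\in G,\qquad\forall i,j,$$ under the CFL-type condition $$\frac{\Delta t}{\Delta x}\tilde\alpha_x+\frac{\Delta t}{\Delta y}\tilde\alpha_y<\frac{\theta\hat\omega_1}2,\qquad\theta=\frac{\Delta t}{\tau_{max}}\in(0,1],$$ where $\tilde\alpha_x=\max_{i,j}\max\{\tilde\alpha_{x,ij}^D,\tilde\alpha_{x,i+\frac12,j+\frac12}^C\}$ and $\tilde\alpha_y=\max_{i,j}\max\{\tilde\alpha_{y,ij}^D,\tilde\alpha_{y,i+\frac1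2,j+\frac12}^C\}$.
   Context: **Equations.** Two-dimensional Euler equations with gravitational potential $\phi(x,y)$: $\mathbf U_t+\nabla\cdot\mathbf F(\mathbf U)=\mathbf S(\mathbf U,\nabla\phi)$, $\mathbf U=(\rho,\mathbf m,E)^\top=(\rho,\rho u_1,\rho u_2,E)^\top$, $\mathbf F_1=(\rho u_1,\rho u_1^2+p,\rho u_1u_2,(E+p)u_1)^\top$, $\mathbf F_2=(\rho u_2,\rho u_1u_2,\rho u_2^2+p,(E+p)u_2)^\top$, $\mathbf S=(0,-\rho\phi_x,-\rho\phi_y,-\mathbf m\cdot\nabla\phi)^\top$, $p(\mathbf U)=(\gamma-1)(E-\frac{|\mathbf m|^2}{2\rho})$, $\gamma>1$. Admissible set $G=\{(\rho,\mathbf m,E)^\top:\rho>0,\ p(\mathbf U)>0\}$. $a_x(\mathbf U)=|u_1|+\sqrt{\gamma p/\rho}$, $a_y(\mathbf U)=|u_2|+\sqrt{\gamma p/\rho}$. A known stationary hydrostatic solution $\rho^s(x,y)$, $u_1^s=u_2^s=0$, $p^s(x,y)$ with $\nabla p^s=-\rho^s\nabla\phi$ is given, and $\mathbf U^s=(\rho^s,0,0,p^s/(\gamma-1))^\top$. **Meshes and spaces.** Uniform grids $x_a,y_b$, with $a,b$ integers or half-integers, $x_{a+\frac12}-x_a=\Delta x/2$, $y_{b+\frac12}-y_b=\Delta y/2$; $I_{a,b}=(x_{a-\frac12},x_{a+\frac12})\times(y_{b-\frac12},y_{b+\frac12})$. Cells $I_{i,j}$ with integer indices form the primal mesh (label $C$),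 cells $I_{i+\frac12,j+\frac12}$ the dual mesh (label $D$). $\mathbb V_h^{C,k},\mathbb V_h^{D,k}$ are the spaces of functions which on each primal, respectively dual, cell are polynomials in $(x,y)$ of total degree at most $k$; $k\ge2$; $\mathbf U_h^C\in[\mathbb V_h^{C,k}]^4$, $\mathbf U_h^D\in[\mathbb V_h^{D,k}]^4$. For a cell $I_{a,b}$ write $(A,B)=(C,D)$ if $a,b$ are integers and $(A,B)=(D,C)$ if both are half-integers. There are finitely many cells; conclusions range over those cells for which all four overlapping cells of the other mesh are present (boundary treatment is not part of the statement). $\overline{(g)}_{ab}=\frac1{\Delta x\Delta y}\int_{I_{a,b}}g\,dxdy$; $\overline{\mathbf U}^C_{ab},\overline{\mathbf U}^D_{ab}$ are the averages of $\mathbf U_h^C,\mathbf U_h^D$ over $I_{a,b}$. **Projection.** The four quarter cells of $I_{a,b}$ are $I^0_{a,b}=(x_{a-\frac12},x_a)\times(y_{b-\frac12},y_b)$, $I^1_{a,b}=(x_a,x_{a+\frac12})\times(y_{b-\frac12},y_b)$, $I^2_{a,b}=(x_{a-\frac12},x_a)\times(y_b,y_{b+\frac12})$, $I^3_{a,b}=(x_a,x_{a+\frac12})\times(y_b,y_{b+\frac12})$. Let $\xi=2(x-x_a)/\Delta x$, $\eta=2(y-y_b)/\Delta y$, and let $\Phi_0=1,\Phi_1=\xi,\Phi_2=\eta,\Phi_3=\xi\eta,\Phi_4=\xi^2-\frac13,\Phi_5=\eta^2-\frac13,\dots,\Phi_K$ ($K=k(k+3)/2$) be the orthogonal (scaled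 Legendre) basis of $\mathbb P^k(I_{a,b})$. $\mathcal P_h^A(f)\in\mathbb V_h^{A,k}$ is determined on each cell of mesh $A$ by $\int_{I^m_{a,b}}\mathcal P_h^A(f)=\int_{I^m_{a,b}}f$ for $m=0,1,2$ and $\int_{I_{a,b}}\mathcal P_h^A(f)v=\int_{I_{a,b}}fv$ for all $v\in\mathrm{span}\{\Phi_0,\Phi_4,\dots,\Phi_K\}$. $\mathbf U_h^{s,A}$ is the componentwise projection of $\mathbf U^s$; $\rho_h^{s,A}=\mathcal P_h^A(\rho^s)$, $p_h^{s,A}=\mathcal P_h^A(p^s)$. **Quadrature and point sets.** In $[x_{a-\frac12},x_a]$ and $[x_a,x_{a+\frac12}]$ let $\mathbb Q_a^{1,x}=\{x_a^{1,\alpha}\}$, $\mathbb Q_a^{2,x}=\{x_a^{2,\alpha}\}$ be the $N$-point Gauss nodes (weights $\omega_\alpha$, $\sum_\alpha\omega_\alpha=1$, $N\ge k+1$), and $\mathbb L_a^{1,x},\mathbb L_a^{2,x}$ the $L$-point Gauss–Lobatto nodes (weights $\hat\omega_\beta$, $\sum_\beta\hat\omega_\beta=1$, $L=\lceil\frac{k+3}2\rceil$; $\hat\omega_1$ is the first, endpoint, weight). Define $\mathbb Q_b^{\tau,y}=\{y_b^{\tau,\mu}\}$, $\mathbb L_b^{\tau,y}$ analogously. For $\kappa,\tau\in\{1,2\}$, $$\mathbb S_{ab}^{\kappa,\tau}=(\mathbb Q_a^{\kappa,x}\otimes\mathbb L_b^{\tau,y})\cup(\mathbb L_a^{\kappa,x}\otimes\mathbb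 Q_b^{\tau,y})\cup(\mathbb Q_a^{\kappa,x}\otimes\mathbb Q_b^{\tau,y}),\qquad \mathbb Q_{ab}^{\kappa,\tau}=\mathbb Q_a^{\kappa,x}\otimes\mathbb Q_b^{\tau,y},$$ $\mathbb S_{ab}=\bigcup_{\kappa,\tau}\mathbb S_{ab}^{\kappa,\tau}$, $\mathbb Q_{ab}=\bigcup_{\kappa,\tau}\mathbb Q_{ab}^{\kappa,\tau}$. Each $\mathbb S_{ab}^{\kappa,\tau}$ lies in the closure of one quarter cell of $I_{a,b}$; at points of $\mathbb S_{ab}^{\kappa,\tau}$ a piecewise polynomial (on either mesh) is evaluated by its limit from inside that quarter cell. Define $$\delta^x_{ab}(f)=\sum_{\kappa=1}^2\sum_{\alpha=1}^N\frac{\omega_\alpha}2\big(f(x_{a+\frac12},y_b^{\kappa,\alpha})-f(x_{a-\frac12},y_b^{\kappa,\alpha})\big),\quad \delta^y_{ab}(f)=\sum_{\kappa=1}^2\sum_{\alpha=1}^N\frac{\omega_\alpha}2\big(f(x_a^{\kappa,\alpha},y_{b+\frac12})-f(x_a^{\kappa,\alpha},y_{b-\frac12})\big).$$ **Cell-average operators** (obtained by taking test function $1$ in the modified CDG scheme). Let $\mathbf Q=(\mathbf Q_1,\mathbf Q_2)$, $\mathbf Q_1=(0,\rho,0,\rho u_1)^\top$, $\mathbf Q_2=(0,0,\rho,\rho u_2)^\top$ (a $4\times2$ matrix), $\mathbf R=\overline{(\mathbf Q_h^B)}_{ab}/\overline{(\rho_h^{s,B})}_{ab}$, $z=(x_a^{\kappa,\alpha},y_b^{\sigma,\mu})$.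 Then $$\mathbf L_{ab}^A(\mathbf U_h^A,\mathbf U_h^B)=\frac{\overline{\mathbf U}^B_{ab}-\overline{\mathbf U}^A_{ab}}{\tau_{max}}-\frac{\delta^x_{ab}(\mathbf F_1(\mathbf U_h^B))}{\Delta x}-\frac{\delta^y_{ab}(\mathbf F_2(\mathbf U_h^B))}{\Delta y}+\frac{\langle\mathbf S_h^B,1\rangle_{ab}}{\Delta x\Delta y},$$ $$\langle\mathbf S_h^B,1\rangle_{ab}=\frac{\Delta x\Delta y}4\sum_{\kappa,\sigma=1}^2\sum_{\alpha,\mu=1}^N\omega_\alpha\omega_\mu\Big(\frac{\mathbf Q_h^B(z)}{\rho_h^{s,B}(z)}-\mathbf R\Big)\nabla p_h^{s,B}(z)+\mathbf R\begin{pmatrix}\Delta y\,\delta^x_{ab}(p_h^{s,B})\\ \Delta x\,\delta^y_{ab}(p_h^{s,B})\end{pmatrix}.$$ Here $\tau_{max}>0$ is a given time scale and $\Delta t>0$ the time step. **Wave-speed parameters.** For each cell $I_{a,b}$ (so $\tilde\alpha^D_{\cdot,ij}$ on primal cells, $\tilde\alpha^C_{\cdot,i+\frac12,j+\frac12}$ on dual cells): $$\tilde\alpha_{x,ab}^B=\max_{\mathbb S_{ab}}a_x(\mathbf U_h^B)+\frac{\hat\omega_1\Delta x}4\tilde\alpha_s^B,\qquad \tilde\alpha_{y,ab}^B=\max_{\mathbb S_{ab}}a_y(\mathbf U_h^B)+\frac{\hat\omega_1\Delta y}4\tilde\alpha_s^B,$$ $$\tilde\alpha_s^B=\max_{\mathbb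 Q_{ab}}\Big\{|\nabla\hat\phi_h^B|\sqrt{\frac{(\gamma-1)\rho_h^B}{2p_h^B}}\Big\},\qquad \nabla\hat\phi_h^B=-\frac{\nabla p_h^{s,B}}{\rho_h^{s,B}}-\frac{(J^x_{ab},J^y_{ab})^\top}{\overline{(\rho_h^{s,B})}_{ab}\,\Delta x\Delta y},$$ $$J^x_{ab}=\int_{y_{b-\frac12}}^{y_{b+\frac12}}\big(p_h^{s,B}(x_a^+,y)-p_h^{s,B}(x_a^-,y)\big)dy,\qquad J^y_{ab}=\int_{x_{a-\frac12}}^{x_{a+\frac12}}\big(p_h^{s,B}(x,y_b^+)-p_h^{s,B}(x,y_b^-)\big)dx,$$ where $p_h^B=p(\mathbf U_h^B)$, $\nabla\hat\phi_h^B$ is just notation for the displayed vector field, and superscripts $\pm$ denote one-sided limits. *)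

theory Defs
  imports "HOL-Analysis.Analysis" "HOL-Computational_Algebra.Polynomial"
begin

section \<open>Euler equations with gravity\<close>

text \<open>
  Conservative variables \<open>U = (\<rho>, m\<^sub>1, m\<^sub>2, E)\<close> are vectors in \<open>real ^ 4\<close>, with
  \<open>m\<^sub>i = \<rho> u\<^sub>i\<close>. The entries \<open>\<rho> u\<^sub>i\<close> of the fluxes and of \<open>Q\<close> are the momentum
  components \<open>m\<^sub>i\<close>.
\<close>

definition vel1 :: "real ^ 4 \<Rightarrow> real" where "vel1 U = U $ 2 / U $ 1"

definition vel2 :: "real ^ 4 \<Rightarrow> real" where "vel2 U = U $ 3 / U $ 1"

definition pressure :: "real \<Rightarrow> real ^ 4 \<Rightarrow> real" where
  "pressure \<gamma> U = (\<gamma> - 1) * (U $ 4 - ((U $ 2)\<^sup>2 + (U $ 3)\<^sup>2) / (2 * U $ 1))"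

definition admissible :: "real \<Rightarrow> (real ^ 4) set" where
  "admissible \<gamma> = {U. U $ 1 > 0 \<and> pressure \<gamma> U > 0}"

definition flux1 :: "real \<Rightarrow> real ^ 4 \<Rightarrow> real ^ 4" where
  "flux1 \<gamma> U = vector [U $ 2,
                       U $ 1 * (vel1 U)\<^sup>2 + pressure \<gamma> U,
                       U $ 1 * vel1 U * vel2 U,
                       (U $ 4 + pressure \<gamma> U) * vel1 U]"

definition flux2 :: "real \<Rightarrow> real ^ 4 \<Rightarrow> real ^ 4" where
  "flux2 \<gamma> U = vector [U $ 3,
                       U $ 1 * vel1 U * vel2 U,
                       U $ 1 * (vel2 U)\<^sup>2 + pressure \<gamma> U,
                       (U $ 4 + pressure \<gamma> U) * vel2 U]"

definition speed_x :: "real \<Rightarrow> real ^ 4 \<Rightarrow> real" where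
  "speed_x \<gamma> U = \<bar>vel1 U\<bar> + sqrt (\<gamma> * pressure \<gamma> U / U $ 1)"

definition speed_y :: "real \<Rightarrow> real ^ 4 \<Rightarrow> real" where
  "speed_y \<gamma> U = \<bar>vel2 U\<bar> + sqrt (\<gamma> * pressure \<gamma> U / U $ 1)"

text \<open>The \<open>4 \<times> 2\<close> matrix \<open>Q = (Q\<^sub>1, Q\<^sub>2)\<close>, listed by rows.\<close>

definition Qmat :: "real ^ 4 \<Rightarrow> real ^ 2 ^ 4" where
  "Qmat U = vector [vector [0, 0], vector [U $ 1, 0], vector [0, U $ 1], vector [U $ 2, U $ 3]]"

definition grad :: "(real \<times> real \<Rightarrow> real) \<Rightarrow> real \<times> real \<Rightarrow> real ^ 2" where
  "grad f z = vector [deriv (\<lambda>x. f (x, snd z)) (fst z), deriv (\<lambda>y. f (fst z, y)) (snd z)]"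

text \<open>
  The state at rest with density \<open>\<rho>\<^sup>s\<close> and pressure \<open>p\<^sup>s\<close> is stationary: \<open>\<nabla>p\<^sup>s = - \<rho>\<^sup>s \<nabla>\<phi>\<close> on the physical domain \<open>\<Omega>\<close>.
\<close>

definition hydrostatic ::
  "(real \<times> real) set \<Rightarrow> (real \<times> real \<Rightarrow> real) \<Rightarrow> (real \<times> real \<Rightarrow> real) \<Rightarrow> (real \<times> real \<Rightarrow> real) \<Rightarrow> bool"
  where
  "hydrostatic \<Omega> \<phi> \<rho>s ps \<longleftrightarrow>
     (\<forall>z\<in>\<Omega>. \<phi> differentiable (at z) \<and> ps differentiable (at z) \<and> grad ps z = - (\<rho>s z *\<^sub>R grad \<phi> z))"

definition hydrostatic_state ::
  "real \<Rightarrow> (real \<times> real \<Rightarrow> real) \<Rightarrow> (real \<times> real \<Rightarrow> real) \<Rightarrow> real \<times> real \<Rightarrow> real ^ 4" where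
  "hydrostatic_state \<gamma> \<rho>s ps z = vector [\<rho>s z, 0, 0, ps z / (\<gamma> - 1)]"


section \<open>Quadrature rules\<close>

text \<open>
  Rules on the reference interval \<open>[-1, 1]\<close>, with nodes \<open>t 1 < \<dots> < t N\<close> and weights normalised
  to total mass one. The \<open>N\<close>-point Gauss rule is the \<open>N\<close>-point rule that is exact up to degree
  \<open>2N - 1\<close>; the \<open>L\<close>-point Gauss--Lobatto rule has both endpoints among its nodes and is exact up
  to degree \<open>2L - 3\<close>. These conditions determine nodes and weights uniquely; in particular
  \<open>w\<close> sums to one (take \<open>P = 1\<close>) and is positive.
\<close>

definition exact_for :: "nat \<Rightarrow> (nat \<Rightarrow> real) \<Rightarrow> (nat \<Rightarrow> real) \<Rightarrow> real poly \<Rightarrow> bool" where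
  "exact_for n t w P \<longleftrightarrow> (\<Sum>i=1..n. w i * poly P (t i)) = integral {-1..1} (poly P) / 2"

definition gauss_rule :: "nat \<Rightarrow> (nat \<Rightarrow> real) \<Rightarrow> (nat \<Rightarrow> real) \<Rightarrow> bool" where
  "gauss_rule N t w \<longleftrightarrow>
     strict_mono_on {1..N} t \<and> t ` {1..N} \<subseteq> {-1..1} \<and>
     (\<forall>P. degree P \<le> 2 * N - 1 \<longrightarrow> exact_for N t w P)"

definition gauss_lobatto_rule :: "nat \<Rightarrow> (nat \<Rightarrow> real) \<Rightarrow> (nat \<Rightarrow> real) \<Rightarrow> bool" where
  "gauss_lobatto_rule L t w \<longleftrightarrow>
     strict_mono_on {1..L} t \<and> t 1 = -1 \<and> t L = 1 \<and>
     (\<forall>P. degree P \<le> 2 * L - 3 \<longrightarrow> exact_for L t w P)"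


section \<open>Overlapping meshes\<close>

text \<open>
  The grid data: origin \<open>(x\<^sub>0, y\<^sub>0)\<close>, mesh sizes, and the reference Gauss and Gauss--Lobatto rules.

  Grid indices are doubled, so that half-integers become integers: the index \<open>p :: int\<close> stands for
  \<open>a = p / 2\<close>, and \<open>gx G p\<close> is \<open>x\<^sub>a\<close>. A pair \<open>(p, q)\<close> of even indices is a cell of the primal mesh,
  a pair of odd indices a cell of the dual mesh, and \<open>p \<plusminus> 1\<close> stands for \<open>a \<plusminus> 1/2\<close>.
\<close>

record grid =
  x_orig :: real
  y_orig :: real
  dx :: real
  dy :: real
  ngauss :: nat
  gnode :: "nat \<Rightarrow> real"
  gwt :: "nat \<Rightarrow> real"
  nlob :: nat
  lnode :: "nat \<Rightarrow> real"
  lwt :: "nat \<Rightarrow> real"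

definition gx :: "grid \<Rightarrow> int \<Rightarrow> real" where "gx G p = x_orig G + of_int p * (dx G / 2)"

definition gy :: "grid \<Rightarrow> int \<Rightarrow> real" where "gy G q = y_orig G + of_int q * (dy G / 2)"

definition cell :: "grid \<Rightarrow> int \<Rightarrow> int \<Rightarrow> (real \<times> real) set" where
  "cell G p q = {gx G (p - 1)<..<gx G (p + 1)} \<times> {gy G (q - 1)<..<gy G (q + 1)}"

text \<open>
  The four quarters of a cell are numbered by \<open>\<kappa>, \<tau> \<in> {1, 2}\<close>: \<open>\<kappa> = 1\<close> is the left and \<open>\<kappa> = 2\<close>
  the right half in \<open>x\<close>, similarly \<open>\<tau>\<close> in \<open>y\<close>. Half \<open>\<kappa>\<close> of cell index \<open>p\<close> starts at the grid index
  \<open>half p \<kappa>\<close>, which is \<open>p - 1\<close> or \<open>p\<close>.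
\<close>

definition half :: "int \<Rightarrow> nat \<Rightarrow> int" where "half p \<kappa> = p + int \<kappa> - 2"

definition quarter :: "grid \<Rightarrow> int \<Rightarrow> int \<Rightarrow> nat \<Rightarrow> nat \<Rightarrow> (real \<times> real) set" where
  "quarter G p q \<kappa> \<tau> = {gx G (half p \<kappa>)<..<gx G (half p \<kappa> + 1)} \<times>
                        {gy G (half q \<tau>)<..<gy G (half q \<tau> + 1)}"

definition primal_mesh :: "(int \<times> int) set \<Rightarrow> bool" where
  "primal_mesh M \<longleftrightarrow> finite M \<and> (\<forall>(p, q)\<in>M. even p \<and> even q)"

definition dual_mesh :: "(int \<times> int) set \<Rightarrow> bool" where
  "dual_mesh M \<longleftrightarrow> finite M \<and> (\<forall>(p, q)\<in>M. odd p \<and> odd q)"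

text \<open>The cells of mesh \<open>M\<close> whose four overlapping cells of the other mesh \<open>M'\<close> are all present.\<close>

definition covered :: "(int \<times> int) set \<Rightarrow> (int \<times> int) set \<Rightarrow> (int \<times> int) set" where
  "covered M M' = {(p, q) \<in> M. {p - 1, p + 1} \<times> {q - 1, q + 1} \<subseteq> M'}"

text \<open>Average over a cell, of scalar-, vector- or matrix-valued functions.\<close>

definition cell_avg :: "grid \<Rightarrow> int \<Rightarrow> int \<Rightarrow> (real \<times> real \<Rightarrow> 'a::euclidean_space) \<Rightarrow> 'a" where
  "cell_avg G p q f = (1 / (dx G * dy G)) *\<^sub>R integral (cell G p q) f"


section \<open>Piecewise polynomials and the projection\<close>

definition bipoly :: "nat \<Rightarrow> (real \<times> real \<Rightarrow> real) set" where
  "bipoly k = {f. \<exists>c :: nat \<Rightarrow> nat \<Rightarrow> real. \<forall>x y. f (x, y) = (\<Sum>m\<le>k. \<Sum>n\<le>k - m. c m n * x ^ m * y ^ n)}"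

text \<open>Values on the cell interfaces and outside the mesh are left arbitrary.\<close>

definition Vh :: "grid \<Rightarrow> nat \<Rightarrow> (int \<times> int) set \<Rightarrow> (real \<times> real \<Rightarrow> real) set" where
  "Vh G k M = {f. \<forall>(p, q)\<in>M. \<exists>r\<in>bipoly k. \<forall>z\<in>cell G p q. f z = r z}"

definition Vh4 :: "grid \<Rightarrow> nat \<Rightarrow> (int \<times> int) set \<Rightarrow> (real \<times> real \<Rightarrow> real ^ 4) set" where
  "Vh4 G k M = {U. \<forall>i. (\<lambda>z. U z $ i) \<in> Vh G k M}"

text \<open>
  Monic Legendre polynomials, by their three-term recurrence
  \<open>P\<^sub>n\<^sub>+\<^sub>1 = t P\<^sub>n - n\<^sup>2 / (4 n\<^sup>2 - 1) P\<^sub>n\<^sub>-\<^sub>1\<close>; thus \<open>P\<^sub>2 = t\<^sup>2 - 1/3\<close>.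
\<close>

fun legendre :: "nat \<Rightarrow> real poly" where
  "legendre 0 = 1"
| "legendre (Suc 0) = [:0, 1:]"
| "legendre (Suc (Suc n)) =
     [:0, 1:] * legendre (Suc n) -
     smult ((real (Suc n))\<^sup>2 / (4 * (real (Suc n))\<^sup>2 - 1)) (legendre n)"

text \<open>
  The orthogonal basis of the polynomials of total degree at most \<open>k\<close> on a cell consists of the
  functions \<open>cell_basis G p q m n\<close> with \<open>m + n \<le> k\<close>. The functions \<open>\<Phi>\<^sub>1 = \<xi>\<close>, \<open>\<Phi>\<^sub>2 = \<eta>\<close>,
  \<open>\<Phi>\<^sub>3 = \<xi> \<eta>\<close> are those with \<open>(m, n) = (1, 0), (0, 1), (1, 1)\<close>.
\<close>

definition cell_basis :: "grid \<Rightarrow> int \<Rightarrow> int \<Rightarrow> nat \<Rightarrow> nat \<Rightarrow> real \<times> real \<Rightarrow> real" where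
  "cell_basis G p q m n z =
     poly (legendre m) (2 * (fst z - gx G p) / dx G) * poly (legendre n) (2 * (snd z - gy G q) / dy G)"

definition test_span :: "grid \<Rightarrow> nat \<Rightarrow> int \<Rightarrow> int \<Rightarrow> (real \<times> real \<Rightarrow> real) set" where
  "test_span G k p q =
     {v. \<exists>c :: nat \<Rightarrow> nat \<Rightarrow> real.
           v = (\<lambda>z. \<Sum>(m, n)\<in>{(m, n). m + n \<le> k} - {(1, 0), (0, 1), (1, 1)}. c m n * cell_basis G p q m n z)}"

text \<open>
  \<open>is_proj G k M f g\<close>: the function \<open>g\<close> is the projection of \<open>f\<close> to \<open>Vh G k M\<close>. It is a relation
  because \<open>g\<close> is determined only inside the cells.
\<close>

definition is_proj ::
  "grid \<Rightarrow> nat \<Rightarrow> (int \<times> int) set \<Rightarrow> (real \<times> real \<Rightarrow> real) \<Rightarrow> (real \<times> real \<Rightarrow> real) \<Rightarrow> bool" where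
  "is_proj G k M f g \<longleftrightarrow>
     g \<in> Vh G k M \<and>
     (\<forall>(p, q)\<in>M.
        (\<forall>(\<kappa>, \<tau>)\<in>{(1, 1), (2, 1), (1, 2)}.
           integral (quarter G p q \<kappa> \<tau>) g = integral (quarter G p q \<kappa> \<tau>) f) \<and>
        (\<forall>v\<in>test_span G k p q.
           integral (cell G p q) (\<lambda>z. g z * v z) = integral (cell G p q) (\<lambda>z. f z * v z)))"


section \<open>Point sets and evaluation\<close>

definition xgauss :: "grid \<Rightarrow> int \<Rightarrow> nat \<Rightarrow> nat \<Rightarrow> real" where
  "xgauss G p \<kappa> \<alpha> = gx G (half p \<kappa>) + dx G / 4 * (1 + gnode G \<alpha>)"

definition ygauss :: "grid \<Rightarrow> int \<Rightarrow> nat \<Rightarrow> nat \<Rightarrow> real" where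
  "ygauss G q \<tau> \<mu> = gy G (half q \<tau>) + dy G / 4 * (1 + gnode G \<mu>)"

definition xlob :: "grid \<Rightarrow> int \<Rightarrow> nat \<Rightarrow> nat \<Rightarrow> real" where
  "xlob G p \<kappa> \<beta> = gx G (half p \<kappa>) + dx G / 4 * (1 + lnode G \<beta>)"

definition ylob :: "grid \<Rightarrow> int \<Rightarrow> nat \<Rightarrow> nat \<Rightarrow> real" where
  "ylob G q \<tau> \<beta> = gy G (half q \<tau>) + dy G / 4 * (1 + lnode G \<beta>)"

definition Qset :: "grid \<Rightarrow> int \<Rightarrow> int \<Rightarrow> nat \<Rightarrow> nat \<Rightarrow> (real \<times> real) set" where
  "Qset G p q \<kappa> \<tau> = xgauss G p \<kappa> ` {1..ngauss G} \<times> ygauss G q \<tau> ` {1..ngauss G}"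

definition Sset :: "grid \<Rightarrow> int \<Rightarrow> int \<Rightarrow> nat \<Rightarrow> nat \<Rightarrow> (real \<times> real) set" where
  "Sset G p q \<kappa> \<tau> =
     xgauss G p \<kappa> ` {1..ngauss G} \<times> ylob G q \<tau> ` {1..nlob G} \<union>
     xlob G p \<kappa> ` {1..nlob G} \<times> ygauss G q \<tau> ` {1..ngauss G} \<union>
     Qset G p q \<kappa> \<tau>"

text \<open>
  Evaluation at a point of the closure of quarter \<open>(\<kappa>, \<tau>)\<close>, as the limit from inside that quarter.
  Since a point on the boundary of several quarters carries one value per quarter, conditions and
  maxima over the point sets of a cell range over triples \<open>(\<kappa>, \<tau>, z)\<close>.
\<close>

definition trace ::
  "grid \<Rightarrow> int \<Rightarrow> int \<Rightarrow> (real \<times> real \<Rightarrow> 'a::t2_space) \<Rightarrow> nat \<Rightarrow> nat \<Rightarrow> real \<times> real \<Rightarrow> 'a" where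
  "trace G p q f \<kappa> \<tau> z = Lim (at z within quarter G p q \<kappa> \<tau>) f"

definition admissible_on_S :: "grid \<Rightarrow> real \<Rightarrow> (real \<times> real \<Rightarrow> real ^ 4) \<Rightarrow> int \<Rightarrow> int \<Rightarrow> bool" where
  "admissible_on_S G \<gamma> U p q \<longleftrightarrow>
     (\<forall>\<kappa>\<in>{1, 2}. \<forall>\<tau>\<in>{1, 2}. \<forall>z\<in>Sset G p q \<kappa> \<tau>. trace G p q U \<kappa> \<tau> z \<in> admissible \<gamma>)"

text \<open>The difference operators act on functions \<open>f \<kappa> \<tau> z\<close> built from traces.\<close>

definition delta_x ::
  "grid \<Rightarrow> int \<Rightarrow> int \<Rightarrow> (nat \<Rightarrow> nat \<Rightarrow> real \<times> real \<Rightarrow> 'a::real_vector) \<Rightarrow> 'a" where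
  "delta_x G p q f =
     (\<Sum>\<kappa>=1..2. \<Sum>\<alpha>=1..ngauss G. (gwt G \<alpha> / 2) *\<^sub>R
        (f 2 \<kappa> (gx G (p + 1), ygauss G q \<kappa> \<alpha>) - f 1 \<kappa> (gx G (p - 1), ygauss G q \<kappa> \<alpha>)))"

definition delta_y ::
  "grid \<Rightarrow> int \<Rightarrow> int \<Rightarrow> (nat \<Rightarrow> nat \<Rightarrow> real \<times> real \<Rightarrow> 'a::real_vector) \<Rightarrow> 'a" where
  "delta_y G p q f =
     (\<Sum>\<kappa>=1..2. \<Sum>\<alpha>=1..ngauss G. (gwt G \<alpha> / 2) *\<^sub>R
        (f \<kappa> 2 (xgauss G p \<kappa> \<alpha>, gy G (q + 1)) - f \<kappa> 1 (xgauss G p \<kappa> \<alpha>, gy G (q - 1))))"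


section \<open>Cell-average operator\<close>

text \<open>
  Below, \<open>U\<close>, \<open>\<rho>s\<close>, \<open>ps\<close> without further label are the solution and the projected stationary
  density and pressure of the mesh \<open>B\<close>, while \<open>(p, q)\<close> is a cell of the other mesh \<open>A\<close>.
\<close>

definition Rmat ::
  "grid \<Rightarrow> (real \<times> real \<Rightarrow> real ^ 4) \<Rightarrow> (real \<times> real \<Rightarrow> real) \<Rightarrow> int \<Rightarrow> int \<Rightarrow> real ^ 2 ^ 4" where
  "Rmat G U \<rho>s p q = (1 / cell_avg G p q \<rho>s) *\<^sub>R cell_avg G p q (\<lambda>z. Qmat (U z))"

definition source ::
  "grid \<Rightarrow> (real \<times> real \<Rightarrow> real ^ 4) \<Rightarrow> (real \<times> real \<Rightarrow> real) \<Rightarrow> (real \<times> real \<Rightarrow> real) \<Rightarrow>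
   int \<Rightarrow> int \<Rightarrow> real ^ 4" where
  "source G U \<rho>s ps p q =
     (dx G * dy G / 4) *\<^sub>R
       (\<Sum>\<kappa>=1..2. \<Sum>\<sigma>=1..2. \<Sum>\<alpha>=1..ngauss G. \<Sum>\<mu>=1..ngauss G.
          let z = (xgauss G p \<kappa> \<alpha>, ygauss G q \<sigma> \<mu>) in
          (gwt G \<alpha> * gwt G \<mu>) *\<^sub>R
            (((1 / trace G p q \<rho>s \<kappa> \<sigma> z) *\<^sub>R Qmat (trace G p q U \<kappa> \<sigma> z) - Rmat G U \<rho>s p q)
               *v trace G p q (grad ps) \<kappa> \<sigma> z)) +
     Rmat G U \<rho>s p q *v
       vector [dy G * delta_x G p q (trace G p q ps), dx G * delta_y G p q (trace G p q ps)]"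

definition Lop ::
  "grid \<Rightarrow> real \<Rightarrow> real \<Rightarrow> (real \<times> real \<Rightarrow> real ^ 4) \<Rightarrow> (real \<times> real \<Rightarrow> real ^ 4) \<Rightarrow>
   (real \<times> real \<Rightarrow> real) \<Rightarrow> (real \<times> real \<Rightarrow> real) \<Rightarrow> int \<Rightarrow> int \<Rightarrow> real ^ 4" where
  "Lop G \<gamma> \<tau>max UA U \<rho>s ps p q =
     (1 / \<tau>max) *\<^sub>R (cell_avg G p q U - cell_avg G p q UA)
     - (1 / dx G) *\<^sub>R delta_x G p q (\<lambda>\<kappa> \<tau> z. flux1 \<gamma> (trace G p q U \<kappa> \<tau> z))
     - (1 / dy G) *\<^sub>R delta_y G p q (\<lambda>\<kappa> \<tau> z. flux2 \<gamma> (trace G p q U \<kappa> \<tau> z))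
     + (1 / (dx G * dy G)) *\<^sub>R source G U \<rho>s ps p q"


section \<open>Wave-speed parameters\<close>

definition jump_x :: "grid \<Rightarrow> (real \<times> real \<Rightarrow> real) \<Rightarrow> int \<Rightarrow> int \<Rightarrow> real" where
  "jump_x G ps p q =
     integral {gy G (q - 1)..gy G (q + 1)}
       (\<lambda>y. Lim (at_right (gx G p)) (\<lambda>x. ps (x, y)) - Lim (at_left (gx G p)) (\<lambda>x. ps (x, y)))"

definition jump_y :: "grid \<Rightarrow> (real \<times> real \<Rightarrow> real) \<Rightarrow> int \<Rightarrow> int \<Rightarrow> real" where
  "jump_y G ps p q =
     integral {gx G (p - 1)..gx G (p + 1)}
       (\<lambda>x. Lim (at_right (gy G q)) (\<lambda>y. ps (x, y)) - Lim (at_left (gy G q)) (\<lambda>y. ps (x, y)))"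

definition grad_phi_hat ::
  "grid \<Rightarrow> (real \<times> real \<Rightarrow> real) \<Rightarrow> (real \<times> real \<Rightarrow> real) \<Rightarrow> int \<Rightarrow> int \<Rightarrow>
   nat \<Rightarrow> nat \<Rightarrow> real \<times> real \<Rightarrow> real ^ 2" where
  "grad_phi_hat G \<rho>s ps p q \<kappa> \<tau> z =
     - ((1 / trace G p q \<rho>s \<kappa> \<tau> z) *\<^sub>R trace G p q (grad ps) \<kappa> \<tau> z)
     - (1 / (cell_avg G p q \<rho>s * dx G * dy G)) *\<^sub>R vector [jump_x G ps p q, jump_y G ps p q]"

definition alpha_s ::
  "grid \<Rightarrow> real \<Rightarrow> (real \<times> real \<Rightarrow> real ^ 4) \<Rightarrow> (real \<times> real \<Rightarrow> real) \<Rightarrow> (real \<times> real \<Rightarrow> real) \<Rightarrow>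
   int \<Rightarrow> int \<Rightarrow> real" where
  "alpha_s G \<gamma> U \<rho>s ps p q =
     Max {norm (grad_phi_hat G \<rho>s ps p q \<kappa> \<tau> z) *
          sqrt ((\<gamma> - 1) * trace G p q U \<kappa> \<tau> z $ 1 / (2 * pressure \<gamma> (trace G p q U \<kappa> \<tau> z)))
          | \<kappa> \<tau> z. \<kappa> \<in> {1, 2} \<and> \<tau> \<in> {1, 2} \<and> z \<in> Qset G p q \<kappa> \<tau>}"

definition alpha_x ::
  "grid \<Rightarrow> real \<Rightarrow> (real \<times> real \<Rightarrow> real ^ 4) \<Rightarrow> (real \<times> real \<Rightarrow> real) \<Rightarrow> (real \<times> real \<Rightarrow> real) \<Rightarrow>
   int \<Rightarrow> int \<Rightarrow> real" where
  "alpha_x G \<gamma> U \<rho>s ps p q =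
     Max {speed_x \<gamma> (trace G p q U \<kappa> \<tau> z)
          | \<kappa> \<tau> z. \<kappa> \<in> {1, 2} \<and> \<tau> \<in> {1, 2} \<and> z \<in> Sset G p q \<kappa> \<tau>}
     + lwt G 1 * dx G / 4 * alpha_s G \<gamma> U \<rho>s ps p q"

definition alpha_y ::
  "grid \<Rightarrow> real \<Rightarrow> (real \<times> real \<Rightarrow> real ^ 4) \<Rightarrow> (real \<times> real \<Rightarrow> real) \<Rightarrow> (real \<times> real \<Rightarrow> real) \<Rightarrow>
   int \<Rightarrow> int \<Rightarrow> real" where
  "alpha_y G \<gamma> U \<rho>s ps p q =
     Max {speed_y \<gamma> (trace G p q U \<kappa> \<tau> z)
          | \<kappa> \<tau> z. \<kappa> \<in> {1, 2} \<and> \<tau> \<in> {1, 2} \<and> z \<in> Sset G p q \<kappa> \<tau>}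
     + lwt G 1 * dy G / 4 * alpha_s G \<gamma> U \<rho>s ps p q"

end

theory Submission
  imports Defs
begin

text \<open>
  The theorem holds because admissibility is a family of linear inequalities. For a velocity
  \<open>(a, b)\<close>, the total energy \<open>E - a m\<^sub>1 - b m\<^sub>2 + (a\<^sup>2 + b\<^sup>2) \<rho> / 2\<close> measured by an observer moving with
  that velocity is linear in the state, and for positive density its minimum over \<open>(a, b)\<close>, taken at
  the fluid velocity, is the internal energy. Hence a state is admissible iff its density and all
  these energies are positive (\<open>admissible_iff_moving_energy\<close>). Replacing the strict inequalities by
  weak ones gives a convex cone \<open>adm_cone\<close>, and an admissible state plus an element of the cone is
  admissible. It remains to split the updated average into pieces of this kind.

  Write \<open>A\<close> and \<open>B\<close> for the averages of the two solutions over the cell, \<open>w\<close> for the endpoint weight of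
  the Gauss--Lobatto rule, \<open>a\<close> and \<open>b\<close> for the largest wave speeds in the two directions, \<open>\<alpha>\<close> for the
  source parameter, and \<open>\<theta>\<^sub>x = 2 \<Delta>t a / (w \<Delta>x)\<close>, \<open>\<theta>\<^sub>y = 2 \<Delta>t b / (w \<Delta>y)\<close>. The updated average is
  \<open>(\<theta> - \<theta>\<^sub>x - \<theta>\<^sub>y - \<Delta>t \<alpha>) B + (1 - \<theta>) A + (\<theta>\<^sub>x B - flux in x) + (\<theta>\<^sub>y B - flux in y)
  + \<Delta>t (\<alpha> B + source)\<close>, and the CFL condition says that the coefficient of the first \<open>B\<close> is
  positive.

  For the flux in \<open>x\<close>, the average \<open>B\<close> is written with the Gauss--Lobatto rule in \<open>x\<close> and the Gauss
  rule in \<open>y\<close>, which is exact because on every quarter of the cell the solution is one polynomial. The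
  values at the two faces then occur with weight \<open>w\<close>, and \<open>\<theta>\<^sub>x\<close> is chosen so that they combine with
  the fluxes to \<open>a U - F\<close> or \<open>a U + F\<close>, which lie in the cone when \<open>a\<close> is at least the wave speed
  (\<open>flux_cone\<close>, \<open>flux_x_cone\<close>). This uses that quadrature weights are nonnegative and that the two
  endpoint weights agree (\<open>lobatto_endpoint_weights_eq\<close>).

  For the source, the Gauss rule integrates the pressure gradient exactly, so the face terms of the
  well-balanced correction cancel the volume terms up to the jumps of the pressure across the midlines
  of the cell (\<open>pressure_jump_x\<close>). Therefore the source is the Gauss mean of the genuine gravity source
  with the field \<open>grad_phi_hat\<close> (\<open>source_eq\<close>), and at each Gauss point \<open>\<alpha> U\<close> plus that source lies in
  the cone (\<open>source_cone\<close>). The pointwise estimates for flux and source both come from completing one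
  square (\<open>energy_dominates\<close>).
\<close>

section \<open>The cone of admissible states\<close>

lemma vector_4 [simp]:
  "(vector [a, b, c, d] :: 'a::zero ^ 4) $ 1 = a"
  "(vector [a, b, c, d] :: 'a ^ 4) $ 2 = b"
  "(vector [a, b, c, d] :: 'a ^ 4) $ 3 = c"
  "(vector [a, b, c, d] :: 'a ^ 4) $ 4 = d"
  unfolding vector_def by simp_all

definition moving_energy :: "real \<Rightarrow> real \<Rightarrow> real ^ 4 \<Rightarrow> real" where
  "moving_energy a b U = U $ 4 - a * U $ 2 - b * U $ 3 + (a\<^sup>2 + b\<^sup>2) / 2 * U $ 1"

text \<open>
  The weak form of the linear inequalities in \<open>admissible_iff_moving_energy\<close>. Unlike the set of
  admissible states it contains zero, so that sums over quadrature points may have vanishing weights.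
\<close>
definition adm_cone :: "(real ^ 4) set" where
  "adm_cone = {U. U $ 1 \<ge> 0 \<and> (\<forall>a b. moving_energy a b U \<ge> 0)}"

lemma moving_energy_add: "moving_energy a b (U + V) = moving_energy a b U + moving_energy a b V"
  by (simp add: moving_energy_def field_simps)

lemma moving_energy_scaleR: "moving_energy a b (c *\<^sub>R U) = c * moving_energy a b U"
  by (simp add: moving_energy_def algebra_simps)

text \<open>
  Internal energy plus the kinetic energy of the velocity relative to the observer; the latter vanishes
  for the observer who moves with the fluid.
\<close>
lemma moving_energy_eq:
  assumes "\<gamma> > 1" "U $ 1 > 0"
  shows "moving_energy a b U =
    pressure \<gamma> U / (\<gamma> - 1) + U $ 1 / 2 * ((vel1 U - a)\<^sup>2 + (vel2 U - b)\<^sup>2)"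
  using assms
  by (simp add: moving_energy_def pressure_def vel1_def vel2_def field_simps power2_eq_square)

lemma admissible_iff_moving_energy:
  assumes "\<gamma> > 1"
  shows "U \<in> admissible \<gamma> \<longleftrightarrow> U $ 1 > 0 \<and> (\<forall>a b. moving_energy a b U > 0)"
proof (cases "U $ 1 > 0")
  case True
  have "pressure \<gamma> U > 0" if "\<forall>a b. moving_energy a b U > 0"
  proof -
    have "moving_energy (vel1 U) (vel2 U) U > 0" using that by blast
    then show ?thesis using assms by (simp add: moving_energy_eq[OF assms True] zero_less_divide_iff)
  qed
  moreover have "moving_energy a b U > 0" if "pressure \<gamma> U > 0" for a b
    unfolding moving_energy_eq[OF assms True]
    using that assms True by (intro add_pos_nonneg) auto
  ultimately show ?thesis using True by (auto simp: admissible_def)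
qed (simp add: admissible_def)

lemma adm_cone_0: "0 \<in> adm_cone"
  by (simp add: adm_cone_def moving_energy_def)

lemma adm_cone_add: "U \<in> adm_cone \<Longrightarrow> V \<in> adm_cone \<Longrightarrow> U + V \<in> adm_cone"
  by (simp add: adm_cone_def moving_energy_add)

lemma adm_cone_scaleR: "U \<in> adm_cone \<Longrightarrow> c \<ge> 0 \<Longrightarrow> c *\<^sub>R U \<in> adm_cone"
  by (simp add: adm_cone_def moving_energy_scaleR)

lemma adm_cone_sum: "(\<And>i. i \<in> I \<Longrightarrow> f i \<in> adm_cone) \<Longrightarrow> sum f I \<in> adm_cone"
  by (induction I rule: infinite_finite_induct) (auto intro: adm_cone_0 adm_cone_add)

lemma admissible_imp_adm_cone: "\<gamma> > 1 \<Longrightarrow> U \<in> admissible \<gamma> \<Longrightarrow> U \<in> adm_cone"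
  by (force simp: admissible_iff_moving_energy adm_cone_def intro: less_imp_le)

lemma admissible_add_cone:
  "\<gamma> > 1 \<Longrightarrow> U \<in> admissible \<gamma> \<Longrightarrow> V \<in> adm_cone \<Longrightarrow> U + V \<in> admissible \<gamma>"
  by (auto simp: admissible_iff_moving_energy adm_cone_def moving_energy_add
      intro: add_pos_nonneg)

lemma admissible_scaleR:
  "\<gamma> > 1 \<Longrightarrow> U \<in> admissible \<gamma> \<Longrightarrow> c > 0 \<Longrightarrow> c *\<^sub>R U \<in> admissible \<gamma>"
  by (auto simp: admissible_iff_moving_energy moving_energy_scaleR)

text \<open>
  After multiplication by \<open>a\<close> the inequality follows from \<open>0 \<le> r (h - a w)\<^sup>2\<close>. Here \<open>e\<close> is an internal
  energy, \<open>r w\<^sup>2\<close> a kinetic energy, and \<open>2 h r w\<close> the work done by a force: the pressure in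
  \<open>sound_speed_dominates\<close>, gravity in \<open>source_cone\<close>.
\<close>
lemma energy_dominates:
  fixes a e r h w :: real
  assumes "a \<ge> 0" "r \<ge> 0" "h\<^sup>2 * r \<le> a\<^sup>2 * e"
  shows "2 * h * r * w \<le> a * (e + r * w\<^sup>2)"
proof (cases "a = 0")
  case True
  then have "h\<^sup>2 * r \<le> 0" using assms(3) by simp
  moreover have "h\<^sup>2 * r \<ge> 0" using assms(2) by simp
  ultimately have "h\<^sup>2 * r = 0" by linarith
  then show ?thesis using True by auto
next
  case False
  have "0 \<le> r * (h - a * w)\<^sup>2" using assms by simp
  also have "\<dots> = h\<^sup>2 * r - 2 * h * r * w * a + r * (a * w)\<^sup>2"
    by (simp add: power2_eq_square algebra_simps)
  also have "\<dots> \<le> a\<^sup>2 * e - 2 * h * r * w * a + r * (a * w)\<^sup>2" using assms by simp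
  also have "\<dots> = a * (a * (e + r * w\<^sup>2) - 2 * h * r * w)"
    by (simp add: power2_eq_square algebra_simps)
  finally show ?thesis using False assms(1) by (simp add: zero_le_mult_iff)
qed

text \<open>
  This is the case \<open>r = \<rho> / 2\<close>, \<open>h = P / \<rho>\<close>. Its condition \<open>c\<^sup>2 \<ge> (\<gamma> - 1) P / (2 \<rho>)\<close> is weaker than
  \<open>c\<^sup>2 \<ge> \<gamma> P / \<rho>\<close>.
\<close>
lemma sound_speed_dominates:
  assumes "\<gamma> > 1" "\<rho> > 0" "P > 0" "c \<ge> sqrt (\<gamma> * P / \<rho>)"
  shows "P * \<bar>w\<bar> \<le> c * (P / (\<gamma> - 1) + \<rho> / 2 * w\<^sup>2)"
proof -
  have 0: "sqrt (\<gamma> * P / \<rho>) \<ge> 0" using assms by simp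
  have "\<gamma> * P / \<rho> \<le> c\<^sup>2"
    using assms power_mono[OF assms(4) 0, of 2] by simp
  then have "\<gamma> * P / \<rho> * (P / (\<gamma> - 1)) \<le> c\<^sup>2 * (P / (\<gamma> - 1))"
    using assms by (intro mult_right_mono) auto
  moreover have "(P / \<rho>)\<^sup>2 * (\<rho> / 2) \<le> \<gamma> * P / \<rho> * (P / (\<gamma> - 1))"
  proof -
    have "(P / \<rho>)\<^sup>2 * (\<rho> / 2) = P\<^sup>2 / \<rho> * (1 / 2)" "\<gamma> * P / \<rho> * (P / (\<gamma> - 1)) = P\<^sup>2 / \<rho> * (\<gamma> / (\<gamma> - 1))"
      using assms by (simp_all add: field_simps power2_eq_square)
    moreover have "1 / 2 \<le> \<gamma> / (\<gamma> - 1)" using assms by (simp add: field_simps)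
    moreover have "P\<^sup>2 / \<rho> \<ge> 0" using assms by simp
    ultimately show ?thesis by (simp only: mult_left_mono)
  qed
  ultimately have "(P / \<rho>)\<^sup>2 * (\<rho> / 2) \<le> c\<^sup>2 * (P / (\<gamma> - 1))" by linarith
  from energy_dominates[OF _ _ this, of "\<bar>w\<bar>"] show ?thesis using assms 0 by simp
qed

text \<open>The flux transports the energy with the fluid and adds the work of the pressure.\<close>
lemma moving_energy_flux1:
  assumes "\<gamma> > 1" "U $ 1 > 0"
  shows "moving_energy a b (flux1 \<gamma> U) =
    vel1 U * moving_energy a b U + pressure \<gamma> U * (vel1 U - a)"
  using assms by (simp add: moving_energy_def flux1_def vel1_def vel2_def field_simps power2_eq_square)

lemma moving_energy_flux2:
  assumes "\<gamma> > 1" "U $ 1 > 0"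
  shows "moving_energy a b (flux2 \<gamma> U) =
    vel2 U * moving_energy a b U + pressure \<gamma> U * (vel2 U - b)"
  using assms by (simp add: moving_energy_def flux2_def vel1_def vel2_def field_simps power2_eq_square)

lemma moving_energy_source:
  assumes "U $ 1 > 0"
  shows "moving_energy a b (Qmat U *v g) = U $ 1 * ((vel1 U - a) * g $ 1 + (vel2 U - b) * g $ 2)"
  using assms
  by (simp add: moving_energy_def Qmat_def matrix_vector_mult_def sum_2 vel1_def vel2_def field_simps)

text \<open>
  The two directions are treated together: \<open>u\<close> is the velocity in the direction of the flux \<open>F\<close>, and
  \<open>w\<close> the relative velocity in that direction. Since \<open>a \<plusminus> u\<close> is at least the sound speed, \<open>a \<plusminus> u\<close> times
  the energy dominates the work \<open>p w\<close> of the pressure.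
\<close>
lemma flux_cone:
  assumes \<gamma>: "\<gamma> > 1" and U: "U \<in> admissible \<gamma>"
    and a: "\<bar>u\<bar> + sqrt (\<gamma> * pressure \<gamma> U / U $ 1) \<le> a"
    and F1: "F $ 1 = u * U $ 1"
    and F: "\<And>v1 v2. \<exists>w. moving_energy v1 v2 F = u * moving_energy v1 v2 U + pressure \<gamma> U * w \<and>
      w\<^sup>2 \<le> (vel1 U - v1)\<^sup>2 + (vel2 U - v2)\<^sup>2"
  shows "a *\<^sub>R U - F \<in> adm_cone" "a *\<^sub>R U + F \<in> adm_cone"
proof -
  have \<rho>: "U $ 1 > 0" and p: "pressure \<gamma> U > 0" using U by (auto simp: admissible_def)
  let ?c = "sqrt (\<gamma> * pressure \<gamma> U / U $ 1)"
  have c0: "?c \<ge> 0" using \<rho> p \<gamma> by simp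
  \<comment> \<open>Both signs of the flux at once, with \<open>s = \<plusminus>1\<close>.\<close>
  have s: "a *\<^sub>R U + s *\<^sub>R F \<in> adm_cone" if s: "\<bar>s\<bar> = 1" for s :: real
  proof -
    have su: "\<bar>s * u\<bar> = \<bar>u\<bar>" using s by (simp add: abs_mult)
    then have cc: "a + s * u \<ge> ?c" using a by linarith
    have "(a *\<^sub>R U + s *\<^sub>R F) $ 1 = (a + s * u) * U $ 1" by (simp add: F1 algebra_simps)
    moreover have "(a + s * u) * U $ 1 \<ge> 0"
      using order_trans[OF c0 cc] \<rho> by (intro mult_nonneg_nonneg) auto
    ultimately have "(a *\<^sub>R U + s *\<^sub>R F) $ 1 \<ge> 0" by simp
    moreover have "moving_energy v1 v2 (a *\<^sub>R U + s *\<^sub>R F) \<ge> 0" for v1 v2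
    proof -
      obtain w where w: "moving_energy v1 v2 F = u * moving_energy v1 v2 U + pressure \<gamma> U * w"
        "w\<^sup>2 \<le> (vel1 U - v1)\<^sup>2 + (vel2 U - v2)\<^sup>2" using F by blast
      have "pressure \<gamma> U * \<bar>w\<bar> \<le> (a + s * u) * (pressure \<gamma> U / (\<gamma> - 1) + U $ 1 / 2 * w\<^sup>2)"
        by (rule sound_speed_dominates[OF \<gamma> \<rho> p cc])
      also have "\<dots> \<le> (a + s * u) * moving_energy v1 v2 U"
        unfolding moving_energy_eq[OF \<gamma> \<rho>] using order_trans[OF c0 cc] w(2) \<rho>
        by (intro mult_left_mono add_left_mono) auto
      finally have "pressure \<gamma> U * \<bar>w\<bar> \<le> (a + s * u) * moving_energy v1 v2 U" .
      moreover have "\<bar>s * (pressure \<gamma> U * w)\<bar> = pressure \<gamma> U * \<bar>w\<bar>"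
        using s p by (simp add: abs_mult)
      ultimately have "0 \<le> (a + s * u) * moving_energy v1 v2 U + s * (pressure \<gamma> U * w)"
        by linarith
      then show ?thesis by (simp add: moving_energy_add moving_energy_scaleR w(1) algebra_simps)
    qed
    ultimately show ?thesis by (simp add: adm_cone_def)
  qed
  show "a *\<^sub>R U - F \<in> adm_cone" "a *\<^sub>R U + F \<in> adm_cone"
    using s[of "-1"] s[of 1] by simp_all
qed

lemma flux1_cone:
  assumes "\<gamma> > 1" "U \<in> admissible \<gamma>" "speed_x \<gamma> U \<le> a"
  shows "a *\<^sub>R U - flux1 \<gamma> U \<in> adm_cone" "a *\<^sub>R U + flux1 \<gamma> U \<in> adm_cone"
proof -
  have \<rho>: "U $ 1 > 0" using assms by (simp add: admissible_def)
  have 1: "flux1 \<gamma> U $ 1 = vel1 U * U $ 1" using \<rho> by (simp add: flux1_def vel1_def)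
  have 2: "\<exists>w. moving_energy v1 v2 (flux1 \<gamma> U) = vel1 U * moving_energy v1 v2 U + pressure \<gamma> U * w \<and>
      w\<^sup>2 \<le> (vel1 U - v1)\<^sup>2 + (vel2 U - v2)\<^sup>2" for v1 v2
    using moving_energy_flux1[OF assms(1) \<rho>] by (intro exI[of _ "vel1 U - v1"]) simp
  show "a *\<^sub>R U - flux1 \<gamma> U \<in> adm_cone" "a *\<^sub>R U + flux1 \<gamma> U \<in> adm_cone"
    using flux_cone[OF assms(1,2) _ 1 2] assms(3) by (simp_all add: speed_x_def)
qed

lemma flux2_cone:
  assumes "\<gamma> > 1" "U \<in> admissible \<gamma>" "speed_y \<gamma> U \<le> a"
  shows "a *\<^sub>R U - flux2 \<gamma> U \<in> adm_cone" "a *\<^sub>R U + flux2 \<gamma> U \<in> adm_cone"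
proof -
  have \<rho>: "U $ 1 > 0" using assms by (simp add: admissible_def)
  have 1: "flux2 \<gamma> U $ 1 = vel2 U * U $ 1" using \<rho> by (simp add: flux2_def vel2_def)
  have 2: "\<exists>w. moving_energy v1 v2 (flux2 \<gamma> U) = vel2 U * moving_energy v1 v2 U + pressure \<gamma> U * w \<and>
      w\<^sup>2 \<le> (vel1 U - v1)\<^sup>2 + (vel2 U - v2)\<^sup>2" for v1 v2
    using moving_energy_flux2[OF assms(1) \<rho>] by (intro exI[of _ "vel2 U - v2"]) simp
  show "a *\<^sub>R U - flux2 \<gamma> U \<in> adm_cone" "a *\<^sub>R U + flux2 \<gamma> U \<in> adm_cone"
    using flux_cone[OF assms(1,2) _ 1 2] assms(3) by (simp_all add: speed_y_def)
qed

text \<open>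
  Gravity does the work \<open>\<rho> w \<bullet> g\<close> in the frame of the observer, where \<open>w\<close> is the relative velocity; the
  bound on \<open>a\<close> is the condition under which the internal and kinetic energy dominate it.
\<close>
lemma source_cone:
  assumes \<gamma>: "\<gamma> > 1" and U: "U \<in> admissible \<gamma>"
    and a: "norm g * sqrt ((\<gamma> - 1) * U $ 1 / (2 * pressure \<gamma> U)) \<le> a"
  shows "a *\<^sub>R U - Qmat U *v g \<in> adm_cone"
proof -
  have \<rho>: "U $ 1 > 0" and p: "pressure \<gamma> U > 0" using U by (auto simp: admissible_def)
  have l0: "0 \<le> norm g * sqrt ((\<gamma> - 1) * U $ 1 / (2 * pressure \<gamma> U))" using \<rho> p \<gamma> by simp
  then have a0: "a \<ge> 0" using a by linarith
  have "(norm g)\<^sup>2 * ((\<gamma> - 1) * U $ 1 / (2 * pressure \<gamma> U)) \<le> a\<^sup>2"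
    using power_mono[OF a l0, of 2] \<rho> p \<gamma> by (simp add: power_mult_distrib)
  then have "(norm g)\<^sup>2 * ((\<gamma> - 1) * U $ 1 / (2 * pressure \<gamma> U)) * (pressure \<gamma> U / (\<gamma> - 1))
    \<le> a\<^sup>2 * (pressure \<gamma> U / (\<gamma> - 1))"
    using p \<gamma> by (intro mult_right_mono) auto
  moreover have "(norm g)\<^sup>2 * ((\<gamma> - 1) * U $ 1 / (2 * pressure \<gamma> U)) * (pressure \<gamma> U / (\<gamma> - 1))
    = (norm g)\<^sup>2 * (U $ 1 / 2)" using p \<gamma> by (simp add: divide_simps)
  ultimately have h: "(norm g)\<^sup>2 * (U $ 1 / 2) \<le> a\<^sup>2 * (pressure \<gamma> U / (\<gamma> - 1))"
    by (simp only:)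
  have "moving_energy v1 v2 (a *\<^sub>R U - Qmat U *v g) \<ge> 0" for v1 v2
  proof -
    define w :: "real ^ 2" where "w = vector [vel1 U - v1, vel2 U - v2]"
    have nw: "(norm w)\<^sup>2 = (vel1 U - v1)\<^sup>2 + (vel2 U - v2)\<^sup>2"
      by (simp add: w_def norm_vec_def L2_set_def sum_2)
    have wg: "w \<bullet> g = (vel1 U - v1) * g $ 1 + (vel2 U - v2) * g $ 2"
      by (simp add: w_def inner_vec_def sum_2)
    have "moving_energy v1 v2 (Qmat U *v g) = U $ 1 * (w \<bullet> g)"
      by (simp add: moving_energy_source[OF \<rho>] wg)
    also have "\<dots> \<le> U $ 1 * (norm w * norm g)"
      using \<rho> norm_cauchy_schwarz[of w g] by (intro mult_left_mono) auto
    also have "\<dots> = 2 * norm g * (U $ 1 / 2) * norm w" by simp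
    also have "\<dots> \<le> a * (pressure \<gamma> U / (\<gamma> - 1) + U $ 1 / 2 * (norm w)\<^sup>2)"
      by (rule energy_dominates[OF a0 _ h]) (use \<rho> in simp)
    also have "\<dots> = a * moving_energy v1 v2 U"
      by (simp only: moving_energy_eq[OF \<gamma> \<rho>] nw)
    finally show ?thesis
      using moving_energy_add[of v1 v2 "a *\<^sub>R U" "(-1) *\<^sub>R (Qmat U *v g)"]
      by (simp only: moving_energy_scaleR) simp
  qed
  moreover have "(a *\<^sub>R U - Qmat U *v g) $ 1 \<ge> 0"
    using a0 \<rho> by (simp add: Qmat_def matrix_vector_mult_def sum_2)
  ultimately show ?thesis by (simp add: adm_cone_def)
qed

section \<open>Quadrature rules with nonnegative weights\<close>

definition exact_upto :: "nat \<Rightarrow> nat \<Rightarrow> (nat \<Rightarrow> real) \<Rightarrow> (nat \<Rightarrow> real) \<Rightarrow> bool" where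
  "exact_upto d n t w \<longleftrightarrow> (\<forall>P. degree P \<le> d \<longrightarrow> exact_for n t w P)"

lemma poly_integrable: "poly (P :: real poly) integrable_on {a..b}"
  by (intro integrable_continuous_real continuous_intros)

lemma rule_on_interval:
  assumes ex: "exact_upto d n t w" and deg: "degree P \<le> d" and h: "h > 0"
  shows "(poly P has_integral h * (\<Sum>i=1..n. w i * poly P (c + h / 2 * (1 + t i)))) {c..c + h}"
proof -
  define Q where "Q = pcompose P [:c + h / 2, h / 2:]"
  have pQ: "poly Q x = poly P (c + h / 2 * (1 + x))" for x
  proof -
    have "poly [:c + h / 2, h / 2:] x = c + h / 2 * (1 + x)" by (simp add: field_simps)
    then show ?thesis by (simp only: Q_def poly_pcompose)
  qed
  have "degree Q \<le> d"
    using degree_pcompose_le[of P "[:c + h / 2, h / 2:]"] deg h by (simp add: Q_def)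
  then have 1: "(\<Sum>i=1..n. w i * poly Q (t i)) = integral {-1..1} (poly Q) / 2"
    using ex by (simp add: exact_upto_def exact_for_def)
  have "((\<lambda>x. (h / 2) *\<^sub>R poly P (c + h / 2 * (1 + x))) has_integral
      integral {c + h / 2 * (1 + (-1))..c + h / 2 * (1 + 1)} (poly P)) {-1..1}"
    by (rule has_integral_substitution[where c = c and d = "c + h"])
       (use h in \<open>auto intro!: derivative_eq_intros continuous_intros simp: mult_le_cancel_left\<close>)
  then have "((\<lambda>x. h / 2 * poly Q x) has_integral integral {c..c + h} (poly P)) {-1..1}"
    by (simp add: pQ)
  then have "integral {-1..1} (\<lambda>x. h / 2 * poly Q x) = integral {c..c + h} (poly P)"
    by (rule integral_unique)
  then have "integral {c..c + h} (poly P) = h * (\<Sum>i=1..n. w i * poly Q (t i))"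
    unfolding 1 by simp
  then show ?thesis using poly_integrable[of P c "c + h"]
    by (simp add: pQ has_integral_iff)
qed

lemma rule_nonneg:
  assumes "exact_for n t w P" "\<And>x. x \<in> {-1..1} \<Longrightarrow> poly P x \<ge> 0"
  shows "(\<Sum>i=1..n. w i * poly P (t i)) \<ge> 0"
  using assms(1) integral_nonneg[OF poly_integrable[of P "-1" 1]] assms(2) by (simp add: exact_for_def)

text \<open>
  Exactness for a nonnegative polynomial that vanishes at all nodes but one leaves only the weight of
  that node.
\<close>
lemma weight_nonneg:
  assumes ex: "exact_for n t w P" and pos: "\<And>x. x \<in> {-1..1} \<Longrightarrow> poly P x \<ge> 0"
    and i: "i \<in> {1..n}" and Pi: "poly P (t i) > 0"
    and z: "\<And>j. j \<in> {1..n} \<Longrightarrow> j \<noteq> i \<Longrightarrow> poly P (t j) = 0"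
  shows "w i \<ge> 0"
proof -
  have "(\<Sum>j=1..n. w j * poly P (t j)) = (\<Sum>j=1..n. if j = i then w i * poly P (t i) else 0)"
    by (rule sum.cong) (auto simp: z)
  also have "\<dots> = w i * poly P (t i)" using i by simp
  finally show ?thesis using rule_nonneg[OF ex pos] Pi by (simp add: zero_le_mult_iff)
qed

definition square_at_nodes :: "(nat \<Rightarrow> real) \<Rightarrow> nat set \<Rightarrow> real poly" where
  "square_at_nodes t J = (\<Prod>j\<in>J. [:- t j, 1:])\<^sup>2"

lemma square_at_nodes:
  assumes "finite J"
  shows "degree (square_at_nodes t J) = 2 * card J" "poly (square_at_nodes t J) x \<ge> 0"
    "j \<in> J \<Longrightarrow> poly (square_at_nodes t J) (t j) = 0"
    "x \<notin> t ` J \<Longrightarrow> poly (square_at_nodes t J) x > 0"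
  using assms
  by (auto simp: square_at_nodes_def degree_power_eq degree_prod_eq_sum_degree poly_prod prod_zero_iff
      degree_prod_sum_eq)

lemma gauss_weight_nonneg:
  assumes "gauss_rule n t w" "i \<in> {1..n}"
  shows "w i \<ge> 0"
proof (rule weight_nonneg)
  let ?J = "{1..n} - {i}"
  let ?P = "square_at_nodes t ?J"
  have inj: "inj_on t {1..n}" using assms(1) by (auto simp: gauss_rule_def intro: strict_mono_on_imp_inj_on)
  have "degree ?P \<le> 2 * n - 1" using assms(2) by (simp add: square_at_nodes(1))
  then show "exact_for n t w ?P" using assms(1) by (simp add: gauss_rule_def)
  show "poly ?P (t i) > 0"
    using assms(2) inj by (intro square_at_nodes(4)) (auto dest: inj_onD)
qed (use assms(2) in \<open>auto simp: square_at_nodes\<close>)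

lemma lobatto_node_range:
  assumes "gauss_lobatto_rule n t w" "i \<in> {1..n}"
  shows "t i \<in> {-1..1}"
proof -
  have m: "strict_mono_on {1..n} t" "t 1 = -1" "t n = 1"
    using assms(1) by (auto simp: gauss_lobatto_rule_def)
  have "t 1 \<le> t i" "t i \<le> t n"
    using strict_mono_on_leD[OF m(1)] assms(2) by auto
  then show ?thesis using m by simp
qed

text \<open>
  For \<open>s = \<plusminus>1\<close> this polynomial vanishes at the endpoint \<open>-s\<close> and doubly at the interior nodes, so that
  it sees the node \<open>s\<close> only. Its degree is the largest for which the rule is exact.
\<close>
definition endpoint_poly :: "(nat \<Rightarrow> real) \<Rightarrow> nat \<Rightarrow> real \<Rightarrow> real poly" where
  "endpoint_poly t n s = [:1, s:] * square_at_nodes t {2..n - 1}"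

lemma poly_endpoint_poly:
  "poly (endpoint_poly t n s) x = (1 + s * x) * poly (square_at_nodes t {2..n - 1}) x"
  by (simp add: endpoint_poly_def algebra_simps)

lemma endpoint_poly:
  assumes "gauss_lobatto_rule n t w" "n \<ge> 2" "\<bar>s\<bar> = 1"
  shows "degree (endpoint_poly t n s) \<le> 2 * n - 3"
    "x \<in> {-1..1} \<Longrightarrow> poly (endpoint_poly t n s) x \<ge> 0"
    "j \<in> {1..n} \<Longrightarrow> t j \<noteq> s \<Longrightarrow> poly (endpoint_poly t n s) (t j) = 0"
    "poly (endpoint_poly t n s) s > 0"
proof -
  have m: "strict_mono_on {1..n} t" "t 1 = -1" "t n = 1"
    using assms(1) by (auto simp: gauss_lobatto_rule_def)
  have s: "s = 1 \<or> s = -1" using assms(3) by linarith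
  have "degree (endpoint_poly t n s) \<le> degree [:1, s:] + degree (square_at_nodes t {2..n - 1})"
    unfolding endpoint_poly_def by (rule degree_mult_le)
  also have "\<dots> \<le> 1 + 2 * card {2..n - 1}" by (simp add: square_at_nodes(1))
  finally show "degree (endpoint_poly t n s) \<le> 2 * n - 3" using assms(2) by simp
  show "x \<in> {-1..1} \<Longrightarrow> poly (endpoint_poly t n s) x \<ge> 0"
    unfolding poly_endpoint_poly using s
    by (intro mult_nonneg_nonneg square_at_nodes) auto
  show "poly (endpoint_poly t n s) (t j) = 0" if "j \<in> {1..n}" "t j \<noteq> s"
  proof (cases "j \<in> {2..n - 1}")
    case True
    then show ?thesis by (simp add: poly_endpoint_poly square_at_nodes)
  next
    case False
    then have "j = 1 \<or> j = n" using that(1) by auto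
    then show ?thesis using m s that(2) by (auto simp: poly_endpoint_poly)
  qed
  have "t 1 < t j" "t j < t n" if "j \<in> {2..n - 1}" for j
    using that assms(2) strict_mono_onD[OF m(1), of 1 j] strict_mono_onD[OF m(1), of j n] by auto
  then have "s \<notin> t ` {2..n - 1}" using s m by fastforce
  then show "poly (endpoint_poly t n s) s > 0"
    unfolding poly_endpoint_poly using s by (intro mult_pos_pos square_at_nodes) auto
qed

lemma lobatto_weight_nonneg:
  assumes L: "gauss_lobatto_rule n t w" and n: "n \<ge> 2" and i: "i \<in> {1..n}"
  shows "w i \<ge> 0"
proof -
  have m: "strict_mono_on {1..n} t" "t 1 = -1" "t n = 1"
    and ex: "\<And>P. degree P \<le> 2 * n - 3 \<Longrightarrow> exact_for n t w P"
    using L by (auto simp: gauss_lobatto_rule_def)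
  have inj: "inj_on t {1..n}" using m(1) by (rule strict_mono_on_imp_inj_on)
  show ?thesis
  proof (cases "i = 1 \<or> i = n")
    case True
    then have s: "\<bar>t i\<bar> = 1" using m by auto
    show ?thesis
    proof (rule weight_nonneg[OF _ _ i])
      show "exact_for n t w (endpoint_poly t n (t i))" by (intro ex endpoint_poly(1)[OF L n s])
      show "poly (endpoint_poly t n (t i)) x \<ge> 0" if "x \<in> {-1..1}" for x
        by (rule endpoint_poly(2)[OF L n s that])
      show "poly (endpoint_poly t n (t i)) (t i) > 0" by (rule endpoint_poly(4)[OF L n s])
      show "poly (endpoint_poly t n (t i)) (t j) = 0" if "j \<in> {1..n}" "j \<noteq> i" for j
        using that inj i by (intro endpoint_poly(3)[OF L n s]) (auto dest: inj_onD)
    qed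
  next
    case False
    then have i': "i \<in> {2..n - 1}" using i by auto
    \<comment> \<open>The factor \<open>1 - x\<^sup>2\<close> removes both endpoints and is positive at interior nodes.\<close>
    let ?P = "[:1, 0, -1:] * square_at_nodes t ({2..n - 1} - {i})"
    have "degree ?P \<le> degree [:1, 0, -1 :: real:] + degree (square_at_nodes t ({2..n - 1} - {i}))"
      by (rule degree_mult_le)
    also have "\<dots> \<le> 2 + 2 * card ({2..n - 1} - {i})" by (simp add: square_at_nodes(1))
    also have "\<dots> \<le> 2 * n - 3" using i' by auto
    finally have deg: "degree ?P \<le> 2 * n - 3" .
    show ?thesis
    proof (rule weight_nonneg[OF ex[OF deg] _ i])
      have P: "poly ?P x = (1 - x) * (1 + x) * poly (square_at_nodes t ({2..n - 1} - {i})) x" for x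
        by (simp add: algebra_simps)
      show "poly ?P x \<ge> 0" if "x \<in> {-1..1}" for x
        unfolding P using that by (intro mult_nonneg_nonneg square_at_nodes) auto
      have "t 1 < t i" "t i < t n"
        using i' strict_mono_onD[OF m(1), of 1 i] strict_mono_onD[OF m(1), of i n] by auto
      then show "poly ?P (t i) > 0"
        unfolding P using m i inj_on_eq_iff[OF inj]
        by (intro mult_pos_pos square_at_nodes(4)) auto
      show "poly ?P (t j) = 0" if "j \<in> {1..n}" "j \<noteq> i" for j
      proof (cases "j \<in> {2..n - 1}")
        case True
        then show ?thesis unfolding P using that by (simp add: square_at_nodes)
      next
        case False
        then have "j = 1 \<or> j = n" using that(1) by auto
        then show ?thesis unfolding P using m by auto
      qed
    qed
  qed
qed

text \<open>
  An endpoint weight is the least value of the rule on polynomials that are nonnegative on the interval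
  and equal to one at that endpoint; the minimum is taken at a multiple of \<open>endpoint_poly\<close>. Reflecting
  the interval turns an extremal polynomial for one endpoint into a competitor for the other, and the
  integral is invariant under reflection.
\<close>
lemma lobatto_endpoint_weights_le:
  assumes L: "gauss_lobatto_rule n t w" and n: "n \<ge> 2"
    and ij: "i \<in> {1..n}" "j \<in> {1..n}" "t j = - t i" "\<bar>t i\<bar> = 1"
  shows "w j \<le> w i"
proof -
  have m: "strict_mono_on {1..n} t"
    and ex: "\<And>P. degree P \<le> 2 * n - 3 \<Longrightarrow> exact_for n t w P"
    using L by (auto simp: gauss_lobatto_rule_def)
  have inj: "inj_on t {1..n}" using m(1) by (rule strict_mono_on_imp_inj_on)
  let ?P = "endpoint_poly t n (t i)"
  let ?R = "pcompose ?P [:0, -1:]"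
  note P = endpoint_poly[OF L n ij(4)]
  have R: "poly ?R x = poly ?P (- x)" for x by (simp add: poly_pcompose)
  have exR: "exact_for n t w ?R" using P(1) by (intro ex) (simp add: degree_pcompose)
  have "w i * poly ?P (t i) = (\<Sum>l=1..n. if l = i then w i * poly ?P (t i) else 0)" using ij by simp
  also have "\<dots> = (\<Sum>l=1..n. w l * poly ?P (t l))"
    by (rule sum.cong) (use P(3) inj_on_eq_iff[OF inj] ij in auto)
  also have "\<dots> = integral {-1..1} (poly ?P) / 2"
    using ex[OF P(1)] by (simp add: exact_for_def)
  also have "integral {-1..1} (poly ?P) = integral {-1..1} (poly ?R)"
    using Henstock_Kurzweil_Integration.integral_reflect_real[of 1 "-1" "poly ?P"] by (simp add: R[abs_def])
  also have "\<dots> / 2 = (\<Sum>l=1..n. w l * poly ?R (t l))"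
    using exR by (simp add: exact_for_def)
  also have "\<dots> \<ge> w j * poly ?R (t j)"
    by (rule member_le_sum[of j _ "\<lambda>l. w l * poly ?R (t l)"])
       (use ij lobatto_weight_nonneg[OF L n] lobatto_node_range[OF L] P(2) R in
         \<open>auto intro!: mult_nonneg_nonneg\<close>)
  finally show ?thesis using P(4) R ij by simp
qed

lemma lobatto_endpoint_weights_eq:
  assumes "gauss_lobatto_rule n t w" "n \<ge> 2"
  shows "w n = w 1"
  using lobatto_endpoint_weights_le[OF assms, of 1 n] lobatto_endpoint_weights_le[OF assms, of n 1] assms
  by (auto simp: gauss_lobatto_rule_def intro: antisym)

section \<open>Integration over the quarters of a cell\<close>

definition composite_rule ::
  "nat \<Rightarrow> real \<Rightarrow> (nat \<Rightarrow> real) \<Rightarrow> nat \<Rightarrow> (nat \<Rightarrow> real) \<Rightarrow> (nat \<Rightarrow> nat \<Rightarrow> real) \<Rightarrow> bool" where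
  "composite_rule d h c n w X \<longleftrightarrow>
     (\<forall>\<kappa>. (\<forall>i\<in>{1..n}. X \<kappa> i \<in> {c \<kappa>..c \<kappa> + h}) \<and>
          (\<forall>P. degree P \<le> d \<longrightarrow>
             (poly P has_integral h * (\<Sum>i=1..n. w i * poly P (X \<kappa> i))) {c \<kappa>..c \<kappa> + h}))"

lemma composite_rule_affine:
  assumes "exact_upto d n t w" "t ` {1..n} \<subseteq> {-1..1}" "h > 0"
  shows "composite_rule d h c n w (\<lambda>\<kappa> i. c \<kappa> + h / 2 * (1 + t i))"
proof -
  have "h / 2 * (1 + t i) \<in> {0..h}" if "i \<in> {1..n}" for i
  proof -
    have "t i \<in> {-1..1}" using assms(2) that by blast
    then show ?thesis using assms(3) mult_left_mono[of "1 + t i" 2 "h / 2"] by simp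
  qed
  then show ?thesis
    using rule_on_interval[OF assms(1) _ assms(3)] unfolding composite_rule_def by fastforce
qed

lemma bipoly_sections:
  assumes "r \<in> bipoly k"
  shows "\<exists>P. degree P \<le> k \<and> (\<forall>x. r (x, y) = poly P x)" "\<exists>P. degree P \<le> k \<and> (\<forall>y. r (x, y) = poly P y)"
proof -
  obtain c where c: "\<And>x y. r (x, y) = (\<Sum>m\<le>k. \<Sum>n\<le>k - m. c m n * x ^ m * y ^ n)"
    using assms by (auto simp: bipoly_def)
  define P where "P = (\<Sum>m\<le>k. \<Sum>n\<le>k - m. monom (c m n * y ^ n) m)"
  have "degree P \<le> k"
    unfolding P_def by (intro degree_sum_le finite_atMost) (meson atMost_iff degree_monom_le order_trans)
  moreover have "r (x, y) = poly P x" for x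
    by (simp add: P_def c poly_sum poly_monom mult_ac)
  ultimately show "\<exists>P. degree P \<le> k \<and> (\<forall>x. r (x, y) = poly P x)" by blast
  define Q where "Q = (\<Sum>m\<le>k. \<Sum>n\<le>k - m. monom (c m n * x ^ m) n)"
  have "degree Q \<le> k"
    unfolding Q_def by (intro degree_sum_le finite_atMost) (meson atMost_iff degree_monom_le diff_le_self order_trans)
  moreover have "r (x, y) = poly Q y" for y
    by (simp add: Q_def c poly_sum poly_monom mult_ac)
  ultimately show "\<exists>P. degree P \<le> k \<and> (\<forall>y. r (x, y) = poly P y)" by blast
qed

lemma continuous_on_bipoly:
  assumes "r \<in> bipoly k"
  shows "continuous_on S r"
proof -
  obtain c where c: "\<And>x y. r (x, y) = (\<Sum>m\<le>k. \<Sum>n\<le>k - m. c m n * x ^ m * y ^ n)"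
    using assms by (auto simp: bipoly_def)
  have "r = (\<lambda>z. \<Sum>m\<le>k. \<Sum>n\<le>k - m. c m n * fst z ^ m * snd z ^ n)"
    by (simp add: fun_eq_iff c)
  then show ?thesis by (simp only:) (intro continuous_intros)
qed

lemma continuous_on_grad_bipoly:
  assumes "r \<in> bipoly k"
  shows "continuous_on S (grad r)"
proof -
  obtain c where c: "\<And>x y. r (x, y) = (\<Sum>m\<le>k. \<Sum>n\<le>k - m. c m n * x ^ m * y ^ n)"
    using assms by (auto simp: bipoly_def)
  have "((\<lambda>x. r (x, y)) has_field_derivative
      (\<Sum>m\<le>k. \<Sum>n\<le>k - m. c m n * (real m * x ^ (m - 1)) * y ^ n)) (at x)" for x y
    unfolding c by (auto intro!: derivative_eq_intros sum.cong)
  then have 1: "deriv (\<lambda>x. r (x, y)) x = (\<Sum>m\<le>k. \<Sum>n\<le>k - m. c m n * (real m * x ^ (m - 1)) * y ^ n)"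
    for x y by (rule DERIV_imp_deriv)
  have "((\<lambda>y. r (x, y)) has_field_derivative
      (\<Sum>m\<le>k. \<Sum>n\<le>k - m. c m n * x ^ m * (real n * y ^ (n - 1)))) (at y)" for x y
    unfolding c by (auto intro!: derivative_eq_intros sum.cong)
  then have 2: "deriv (\<lambda>y. r (x, y)) y = (\<Sum>m\<le>k. \<Sum>n\<le>k - m. c m n * x ^ m * (real n * y ^ (n - 1)))"
    for x y by (rule DERIV_imp_deriv)
  have "continuous_on S (\<lambda>z. grad r z $ 1)" "continuous_on S (\<lambda>z. grad r z $ 2)"
    unfolding grad_def vector_2 1 2 by (intro continuous_intros)+
  then have "continuous_on S (\<lambda>z. grad r z $ i)" for i
    using exhaust_2[of i] by auto
  then have "continuous_on S (\<lambda>z. \<chi> i. grad r z $ i)" by (intro continuous_on_vec_lambda)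
  then show ?thesis by simp
qed

lemma integral_tensor:
  assumes X: "composite_rule k h a n v X" and Y: "composite_rule k h' b m w Y" and r: "r \<in> bipoly k"
  shows "(r has_integral h * h' * (\<Sum>i=1..n. \<Sum>j=1..m. v i * w j * r (X \<kappa> i, Y \<tau> j)))
    ({a \<kappa><..<a \<kappa> + h} \<times> {b \<tau><..<b \<tau> + h'})"
proof -
  have inner: "((\<lambda>y. r (x, y)) has_integral h' * (\<Sum>j=1..m. w j * r (x, Y \<tau> j))) {b \<tau>..b \<tau> + h'}" for x
    using bipoly_sections(2)[OF r, of x] Y by (auto simp: composite_rule_def)
  have outer: "((\<lambda>x. r (x, y)) has_integral h * (\<Sum>i=1..n. v i * r (X \<kappa> i, y))) {a \<kappa>..a \<kappa> + h}" for y
    using bipoly_sections(1)[OF r, of y] X by (auto simp: composite_rule_def)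
  have cont: "continuous_on (cbox (a \<kappa>, b \<tau>) (a \<kappa> + h, b \<tau> + h')) r"
    by (rule continuous_on_bipoly[OF r])
  have "((\<lambda>x. h' * (\<Sum>j=1..m. w j * r (x, Y \<tau> j))) has_integral
      h' * (\<Sum>j=1..m. w j * (h * (\<Sum>i=1..n. v i * r (X \<kappa> i, Y \<tau> j))))) {a \<kappa>..a \<kappa> + h}"
    by (intro has_integral_mult_right has_integral_sum outer finite_atLeastAtMost)
  then have "integral {a \<kappa>..a \<kappa> + h} (\<lambda>x. h' * (\<Sum>j=1..m. w j * r (x, Y \<tau> j))) =
      h' * (\<Sum>j=1..m. w j * (h * (\<Sum>i=1..n. v i * r (X \<kappa> i, Y \<tau> j))))"
    by (rule integral_unique)
  also have "\<dots> = h * h' * (\<Sum>j=1..m. \<Sum>i=1..n. v i * w j * r (X \<kappa> i, Y \<tau> j))"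
    by (simp add: sum_distrib_left mult_ac)
  also have "\<dots> = h * h' * (\<Sum>i=1..n. \<Sum>j=1..m. v i * w j * r (X \<kappa> i, Y \<tau> j))"
    by (subst sum.swap) simp
  finally have "integral (cbox (a \<kappa>, b \<tau>) (a \<kappa> + h, b \<tau> + h')) r =
      h * h' * (\<Sum>i=1..n. \<Sum>j=1..m. v i * w j * r (X \<kappa> i, Y \<tau> j))"
    by (simp add: integral_prod_continuous[OF cont] integral_unique[OF inner])
  moreover have "r integrable_on cbox (a \<kappa>, b \<tau>) (a \<kappa> + h, b \<tau> + h')"
    by (rule integrable_continuous[OF cont])
  ultimately have "(r has_integral h * h' * (\<Sum>i=1..n. \<Sum>j=1..m. v i * w j * r (X \<kappa> i, Y \<tau> j)))
      (box (a \<kappa>, b \<tau>) (a \<kappa> + h, b \<tau> + h'))"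
    unfolding has_integral_open_interval by (simp add: has_integral_iff)
  moreover have "box (a \<kappa>, b \<tau>) (a \<kappa> + h, b \<tau> + h') =
      {a \<kappa><..<a \<kappa> + h} \<times> {b \<tau><..<b \<tau> + h'}"
    by (auto simp: box_def Basis_prod_def)
  ultimately show ?thesis by simp
qed

lemma halves: "{1..2} = {1, 2::nat}"
  by auto

lemma sum_quarters: "sum f {1..2::nat} = f 1 + f 2" "sum f {Suc 0..2} = f 1 + f 2"
  by (simp_all add: numeral_2_eq_2)

text \<open>
  The approximate average over a cell that results from the rule \<open>(v, X)\<close> on both halves in \<open>x\<close> and
  the rule \<open>(w, Y)\<close> on both halves in \<open>y\<close>. The factor \<open>1/4\<close> is the share of a quarter.
\<close>
definition tensor_mean ::
  "nat \<Rightarrow> (nat \<Rightarrow> real) \<Rightarrow> (nat \<Rightarrow> nat \<Rightarrow> real) \<Rightarrow> nat \<Rightarrow> (nat \<Rightarrow> real) \<Rightarrow> (nat \<Rightarrow> nat \<Rightarrow> real) \<Rightarrow>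
   (nat \<Rightarrow> nat \<Rightarrow> real \<times> real \<Rightarrow> 'a::real_vector) \<Rightarrow> 'a" where
  "tensor_mean n v X m w Y F = (1 / 4) *\<^sub>R
     (\<Sum>\<kappa>=1..2. \<Sum>\<tau>=1..2. \<Sum>i=1..n. \<Sum>j=1..m. (v i * w j) *\<^sub>R F \<kappa> \<tau> (X \<kappa> i, Y \<tau> j))"

lemma tensor_mean_swap:
  "tensor_mean n v X m w Y F = (1 / 4) *\<^sub>R
     (\<Sum>\<kappa>=1..2. \<Sum>\<tau>=1..2. \<Sum>j=1..m. \<Sum>i=1..n. (v i * w j) *\<^sub>R F \<kappa> \<tau> (X \<kappa> i, Y \<tau> j))"
proof -
  have "(\<Sum>i=1..n. \<Sum>j=1..m. (v i * w j) *\<^sub>R F \<kappa> \<tau> (X \<kappa> i, Y \<tau> j)) =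
    (\<Sum>j=1..m. \<Sum>i=1..n. (v i * w j) *\<^sub>R F \<kappa> \<tau> (X \<kappa> i, Y \<tau> j))" for \<kappa> \<tau>
    by (rule sum.swap)
  then show ?thesis unfolding tensor_mean_def by (simp only:)
qed

lemma tensor_mean_linear:
  assumes "linear f"
  shows "f (tensor_mean n v X m w Y F) = tensor_mean n v X m w Y (\<lambda>\<kappa> \<tau> z. f (F \<kappa> \<tau> z))"
  by (simp add: tensor_mean_def linear_scale[OF assms] linear_sum[OF assms])

lemma tensor_mean_add:
  "tensor_mean n v X m w Y (\<lambda>\<kappa> \<tau> z. F \<kappa> \<tau> z + H \<kappa> \<tau> z) =
   tensor_mean n v X m w Y F + tensor_mean n v X m w Y H"
  by (simp add: tensor_mean_def scaleR_add_right sum.distrib)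

lemma tensor_mean_cong:
  assumes "\<And>\<kappa> \<tau> i j. \<kappa> \<in> {1, 2} \<Longrightarrow> \<tau> \<in> {1, 2} \<Longrightarrow> i \<in> {1..n} \<Longrightarrow> j \<in> {1..m} \<Longrightarrow>
    F \<kappa> \<tau> (X \<kappa> i, Y \<tau> j) = H \<kappa> \<tau> (X \<kappa> i, Y \<tau> j)"
  shows "tensor_mean n v X m w Y F = tensor_mean n v X m w Y H"
  unfolding tensor_mean_def halves using assms by (auto intro!: sum.cong)

section \<open>Traces and cell averages\<close>

text \<open>
  The bound on the number of Gauss--Lobatto points says that their degree of exactness \<open>2 L - 3\<close> is at
  least \<open>k\<close>.
\<close>
locale staggered_grid =
  fixes G :: grid and k :: nat
  assumes dx: "dx G > 0" and dy: "dy G > 0"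
    and gauss_points: "k + 1 \<le> ngauss G" and gauss: "gauss_rule (ngauss G) (gnode G) (gwt G)"
    and lob_points: "k + 3 \<le> 2 * nlob G" and lobatto: "gauss_lobatto_rule (nlob G) (lnode G) (lwt G)"
begin

abbreviation x_rule :: "int \<Rightarrow> nat \<Rightarrow> (nat \<Rightarrow> real) \<Rightarrow> (nat \<Rightarrow> nat \<Rightarrow> real) \<Rightarrow> bool" where
  "x_rule p \<equiv> composite_rule k (dx G / 2) (\<lambda>\<kappa>. gx G (half p \<kappa>))"

abbreviation y_rule :: "int \<Rightarrow> nat \<Rightarrow> (nat \<Rightarrow> real) \<Rightarrow> (nat \<Rightarrow> nat \<Rightarrow> real) \<Rightarrow> bool" where
  "y_rule q \<equiv> composite_rule k (dy G / 2) (\<lambda>\<tau>. gy G (half q \<tau>))"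

lemma rules:
  "x_rule p (ngauss G) (gwt G) (xgauss G p)" "y_rule q (ngauss G) (gwt G) (ygauss G q)"
  "x_rule p (nlob G) (lwt G) (xlob G p)" "y_rule q (nlob G) (lwt G) (ylob G q)"
proof -
  have g: "exact_upto k (ngauss G) (gnode G) (gwt G)" "gnode G ` {1..ngauss G} \<subseteq> {-1..1}"
    using gauss gauss_points by (auto simp: gauss_rule_def exact_upto_def)
  have l: "exact_upto k (nlob G) (lnode G) (lwt G)"
    using lobatto lob_points by (auto simp: gauss_lobatto_rule_def exact_upto_def)
  have l': "lnode G ` {1..nlob G} \<subseteq> {-1..1}"
    using lobatto_node_range[OF lobatto] by blast
  have X: "x_rule p n w (\<lambda>\<kappa> i. gx G (half p \<kappa>) + dx G / 4 * (1 + t i))"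
    if "exact_upto k n t w" "t ` {1..n} \<subseteq> {-1..1}" for n t w
    using composite_rule_affine[OF that, of "dx G / 2"] dx by simp
  have Y: "y_rule q n w (\<lambda>\<kappa> i. gy G (half q \<kappa>) + dy G / 4 * (1 + t i))"
    if "exact_upto k n t w" "t ` {1..n} \<subseteq> {-1..1}" for n t w
    using composite_rule_affine[OF that, of "dy G / 2"] dy by simp
  show "x_rule p (ngauss G) (gwt G) (xgauss G p)" "y_rule q (ngauss G) (gwt G) (ygauss G q)"
    "x_rule p (nlob G) (lwt G) (xlob G p)" "y_rule q (nlob G) (lwt G) (ylob G q)"
    unfolding xgauss_def[abs_def] ygauss_def[abs_def] xlob_def[abs_def] ylob_def[abs_def]
    by (intro X[OF g] Y[OF g] X[OF l l'] Y[OF l l'])+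
qed

lemma quarter_eq:
  "quarter G p q \<kappa> \<tau> = {gx G (half p \<kappa>)<..<gx G (half p \<kappa>) + dx G / 2} \<times>
    {gy G (half q \<tau>)<..<gy G (half q \<tau>) + dy G / 2}"
proof -
  have "gx G (i + 1) = gx G i + dx G / 2" "gy G (i + 1) = gy G i + dy G / 2" for i
    by (simp_all add: gx_def gy_def field_simps)
  then show ?thesis by (simp add: quarter_def)
qed

abbreviation closed_quarter :: "int \<Rightarrow> int \<Rightarrow> nat \<Rightarrow> nat \<Rightarrow> (real \<times> real) set" where
  "closed_quarter p q \<kappa> \<tau> \<equiv> {gx G (half p \<kappa>)..gx G (half p \<kappa>) + dx G / 2} \<times>
    {gy G (half q \<tau>)..gy G (half q \<tau>) + dy G / 2}"

lemma trace_eqI: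
  assumes z: "z \<in> closed_quarter p q \<kappa> \<tau>"
    and f: "\<And>z. z \<in> quarter G p q \<kappa> \<tau> \<Longrightarrow> f z = r z" and r: "continuous_on UNIV r"
  shows "trace G p q f \<kappa> \<tau> z = r z"
proof -
  let ?S = "quarter G p q \<kappa> \<tau>"
  have "z \<in> closure ?S" using z dx dy by (simp add: quarter_eq closure_Times)
  moreover have "open ?S" by (simp add: quarter_eq open_Times)
  ultimately have "z islimpt ?S"
    by (metis closure_def interior_limit_point interior_open Un_iff mem_Collect_eq)
  moreover have "(r \<longlongrightarrow> r z) (at z within ?S)"
    using r by (metis UNIV_I continuous_on_def tendsto_within_subset top_greatest)
  then have "(f \<longlongrightarrow> r z) (at z within ?S)"
    by (rule Lim_transform_eventually) (auto simp: eventually_at_filter f)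
  ultimately show ?thesis
    by (simp add: trace_def tendsto_Lim trivial_limit_within)
qed

lemma trace_grad_eqI:
  assumes z: "z \<in> closed_quarter p q \<kappa> \<tau>"
    and f: "\<And>z. z \<in> quarter G p q \<kappa> \<tau> \<Longrightarrow> f z = r z" and r: "r \<in> bipoly k"
  shows "trace G p q (grad f) \<kappa> \<tau> z = grad r z"
proof (rule trace_eqI[OF z _ continuous_on_grad_bipoly[OF r]])
  fix z assume z: "z \<in> quarter G p q \<kappa> \<tau>"
  obtain x y where xy: "z = (x, y)" by (cases z)
  have o: "open (quarter G p q \<kappa> \<tau>)" by (simp add: quarter_eq open_Times)
  have "\<forall>\<^sub>F x in nhds x. f (x, y) = r (x, y)"
    using z by (intro eventually_nhds_in_open[THEN eventually_mono, of "{gx G (half p \<kappa>)<..<gx G (half p \<kappa>) + dx G / 2}"])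
      (auto simp: xy quarter_eq f)
  moreover have "\<forall>\<^sub>F y in nhds y. f (x, y) = r (x, y)"
    using z by (intro eventually_nhds_in_open[THEN eventually_mono, of "{gy G (half q \<tau>)<..<gy G (half q \<tau>) + dy G / 2}"])
      (auto simp: xy quarter_eq f)
  ultimately show "grad f z = grad r z"
    by (simp add: grad_def xy deriv_cong_ev)
qed

text \<open>
  A piecewise polynomial of one mesh, seen from a cell of the other mesh. The properties used below hold
  for any function of this kind.
\<close>
definition quarterwise_poly :: "int \<Rightarrow> int \<Rightarrow> (real \<times> real \<Rightarrow> real) \<Rightarrow> bool" where
  "quarterwise_poly p q f \<longleftrightarrow>
     (\<exists>r. \<forall>\<kappa>\<in>{1, 2}. \<forall>\<tau>\<in>{1, 2}. r \<kappa> \<tau> \<in> bipoly k \<and> (\<forall>z\<in>quarter G p q \<kappa> \<tau>. f z = r \<kappa> \<tau> z))"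

lemma quarter_subset_cell: "\<kappa> \<in> {1, 2} \<Longrightarrow> \<tau> \<in> {1, 2} \<Longrightarrow> quarter G p q \<kappa> \<tau> \<subseteq> cell G p q"
  using dx dy by (auto simp: quarter_def cell_def half_def gx_def gy_def field_simps)

text \<open>
  Quarter \<open>(\<kappa>, \<tau>)\<close> of a cell is quarter \<open>(3 - \<kappa>, 3 - \<tau>)\<close> of the cell of the other mesh whose index is
  displaced by \<open>2 \<kappa> - 3\<close> and \<open>2 \<tau> - 3\<close>, that is, by \<open>\<plusminus>1\<close>.
\<close>
lemma half_shift: "half (p + 2 * int \<kappa> - 3) (3 - \<kappa>) = half p \<kappa>" if "\<kappa> \<in> {1, 2}"
  using that by (auto simp: half_def)

lemma quarterwise_poly_Vh:
  assumes "f \<in> Vh G k M'" "(p, q) \<in> covered M M'"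
  shows "quarterwise_poly p q f"
proof -
  have "\<exists>r. r \<in> bipoly k \<and> (\<forall>z\<in>quarter G p q \<kappa> \<tau>. f z = r z)" if \<kappa>: "\<kappa> \<in> {1, 2}" and \<tau>: "\<tau> \<in> {1, 2}" for \<kappa> \<tau>
  proof -
    let ?p = "p + 2 * int \<kappa> - 3" and ?q = "q + 2 * int \<tau> - 3"
    have "(?p, ?q) \<in> M'" using assms(2) \<kappa> \<tau> by (auto simp: covered_def add.commute)
    then obtain r where "r \<in> bipoly k" "\<forall>z\<in>cell G ?p ?q. f z = r z"
      using assms(1) by (fastforce simp: Vh_def)
    moreover have "quarter G p q \<kappa> \<tau> = quarter G ?p ?q (3 - \<kappa>) (3 - \<tau>)"
      by (simp only: quarter_def half_shift[OF \<kappa>] half_shift[OF \<tau>])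
    moreover have "quarter G ?p ?q (3 - \<kappa>) (3 - \<tau>) \<subseteq> cell G ?p ?q"
      using \<kappa> \<tau> by (intro quarter_subset_cell) auto
    ultimately show ?thesis by blast
  qed
  then show ?thesis unfolding quarterwise_poly_def by metis
qed

lemma admissible_on_S_covered:
  assumes adm: "\<And>p q. (p, q) \<in> M' \<Longrightarrow> admissible_on_S G \<gamma> U p q" and pq: "(p, q) \<in> covered M M'"
  shows "admissible_on_S G \<gamma> U p q"
  unfolding admissible_on_S_def
proof (intro ballI)
  fix \<kappa> \<tau> :: nat and z
  assume \<kappa>: "\<kappa> \<in> {1, 2}" and \<tau>: "\<tau> \<in> {1, 2}" and z: "z \<in> Sset G p q \<kappa> \<tau>"
  let ?p = "p + 2 * int \<kappa> - 3" and ?q = "q + 2 * int \<tau> - 3"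
  have "(?p, ?q) \<in> M'" using pq \<kappa> \<tau> by (auto simp: covered_def add.commute)
  from adm[OF this] have "\<forall>z\<in>Sset G ?p ?q (3 - \<kappa>) (3 - \<tau>). trace G ?p ?q U (3 - \<kappa>) (3 - \<tau>) z \<in> admissible \<gamma>"
    using \<kappa> \<tau> by (fastforce simp: admissible_on_S_def)
  moreover have "Sset G ?p ?q (3 - \<kappa>) (3 - \<tau>) = Sset G p q \<kappa> \<tau>"
    by (simp only: Sset_def Qset_def xgauss_def xlob_def ygauss_def ylob_def half_shift[OF \<kappa>] half_shift[OF \<tau>] image_def)
  moreover have "quarter G ?p ?q (3 - \<kappa>) (3 - \<tau>) = quarter G p q \<kappa> \<tau>"
    by (simp only: quarter_def half_shift[OF \<kappa>] half_shift[OF \<tau>])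
  ultimately show "trace G p q U \<kappa> \<tau> z \<in> admissible \<gamma>"
    using z by (simp add: trace_def)
qed

text \<open>The quarters fill the cell up to its two midlines, which are negligible.\<close>
lemma has_integral_cell:
  fixes f :: "real \<times> real \<Rightarrow> real"
  assumes "\<And>\<kappa> \<tau>. \<kappa> \<in> {1, 2} \<Longrightarrow> \<tau> \<in> {1, 2} \<Longrightarrow> (f has_integral I \<kappa> \<tau>) (quarter G p q \<kappa> \<tau>)"
  shows "(f has_integral (\<Sum>\<kappa>=1..2. \<Sum>\<tau>=1..2. I \<kappa> \<tau>)) (cell G p q)"
proof -
  let ?Q = "quarter G p q"
  have half12: "half p 1 = p - 1" "half p 2 = p" "half q 1 = q - 1" "half q 2 = q" "half p (Suc 0) = p - 1" "half q (Suc 0) = q - 1"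
    by (simp_all add: half_def)
  have g: "gx G (p - 1) < gx G p" "gx G p < gx G (p + 1)" "gy G (q - 1) < gy G q" "gy G q < gy G (q + 1)"
    using dx dy by (simp_all add: gx_def gy_def field_simps)
  have d: "?Q 1 1 \<inter> ?Q 1 2 = {}" "?Q 2 1 \<inter> ?Q 2 2 = {}" "(?Q 1 1 \<union> ?Q 1 2) \<inter> (?Q 2 1 \<union> ?Q 2 2) = {}"
    by (auto simp: quarter_def half12)
  let ?S = "(?Q 1 1 \<union> ?Q 1 2) \<union> (?Q 2 1 \<union> ?Q 2 2)"
  have "(f has_integral (I 1 1 + I 1 2) + (I 2 1 + I 2 2)) ?S"
    by (intro has_integral_Un assms) (auto simp only: d negligible_empty insert_iff)
  moreover have "negligible ({z :: real \<times> real. z \<bullet> (1, 0) = gx G p} \<union> {z. z \<bullet> (0, 1) = gy G q})"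
    by (intro negligible_Un negligible_standard_hyperplane) (auto simp: Basis_prod_def)
  then have "negligible {z \<in> ?S - cell G p q. f z \<noteq> 0}" "negligible {z \<in> cell G p q - ?S. f z \<noteq> 0}"
    by (rule negligible_subset, use g in \<open>auto simp: quarter_def cell_def half12\<close>)+
  ultimately have "(f has_integral (I 1 1 + I 1 2) + (I 2 1 + I 2 2)) (cell G p q)"
    using has_integral_spike_set_eq by blast
  then show ?thesis by (simp add: sum_quarters)
qed

lemma has_integral_cell_tensor:
  assumes f: "quarterwise_poly p q f" and X: "x_rule p n v X" and Y: "y_rule q m w Y"
  shows "(f has_integral dx G * dy G * tensor_mean n v X m w Y (trace G p q f)) (cell G p q)"
proof -
  obtain r where r: "\<And>\<kappa> \<tau>. \<kappa> \<in> {1, 2} \<Longrightarrow> \<tau> \<in> {1, 2} \<Longrightarrow> r \<kappa> \<tau> \<in> bipoly k"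
    and fr: "\<And>\<kappa> \<tau> z. \<kappa> \<in> {1, 2} \<Longrightarrow> \<tau> \<in> {1, 2} \<Longrightarrow> z \<in> quarter G p q \<kappa> \<tau> \<Longrightarrow> f z = r \<kappa> \<tau> z"
    using f unfolding quarterwise_poly_def by metis
  define I where "I \<kappa> \<tau> = dx G / 2 * (dy G / 2) * (\<Sum>i=1..n. \<Sum>j=1..m. v i * w j * r \<kappa> \<tau> (X \<kappa> i, Y \<tau> j))"
    for \<kappa> \<tau>
  have "(f has_integral I \<kappa> \<tau>) (quarter G p q \<kappa> \<tau>)" if "\<kappa> \<in> {1, 2}" "\<tau> \<in> {1, 2}" for \<kappa> \<tau>
    using has_integral_eq[of "quarter G p q \<kappa> \<tau>" "r \<kappa> \<tau>" f, OF _
        integral_tensor[OF X Y r[OF that], of \<kappa> \<tau>, folded quarter_eq I_def]] fr[OF that]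
    by simp
  then have "(f has_integral (\<Sum>\<kappa>=1..2. \<Sum>\<tau>=1..2. I \<kappa> \<tau>)) (cell G p q)"
    by (rule has_integral_cell)
  also have "(\<Sum>\<kappa>=1..2. \<Sum>\<tau>=1..2. I \<kappa> \<tau>) = dx G * dy G * tensor_mean n v X m w Y r"
    by (simp add: I_def tensor_mean_def sum_quarters algebra_simps)
  also have "tensor_mean n v X m w Y r = tensor_mean n v X m w Y (trace G p q f)"
  proof (rule tensor_mean_cong)
    fix \<kappa> \<tau> i j assume a: "\<kappa> \<in> {1::nat, 2}" "\<tau> \<in> {1::nat, 2}" "i \<in> {1..n}" "j \<in> {1..m}"
    have "(X \<kappa> i, Y \<tau> j) \<in> closed_quarter p q \<kappa> \<tau>"
      using X Y a by (auto simp: composite_rule_def)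
    from trace_eqI[OF this fr[OF a(1,2)] continuous_on_bipoly[OF r[OF a(1,2)]]]
    show "r \<kappa> \<tau> (X \<kappa> i, Y \<tau> j) = trace G p q f \<kappa> \<tau> (X \<kappa> i, Y \<tau> j)" by simp
  qed
  finally show ?thesis .
qed

end

section \<open>Pressure gradients and pressure jumps\<close>

lemma linear_Qmat: "linear Qmat"
  by (rule linearI) (simp_all add: Qmat_def vec_eq_iff forall_4 forall_2)

text \<open>
  A partial derivative of a polynomial of degree at most \<open>k\<close> is again integrated exactly, so the
  fundamental theorem of calculus holds for the quadrature sums themselves.
\<close>
lemma rule_integrates_partials:
  assumes rule: "composite_rule k h c n w X" and h: "h \<ge> 0" and r: "r \<in> bipoly k"
  shows "h * (\<Sum>i=1..n. w i * grad r (X \<kappa> i, y) $ 1) = r (c \<kappa> + h, y) - r (c \<kappa>, y)"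
    "h * (\<Sum>i=1..n. w i * grad r (x, X \<kappa> i) $ 2) = r (x, c \<kappa> + h) - r (x, c \<kappa>)"
proof -
  have *: "h * (\<Sum>i=1..n. w i * poly (pderiv P) (X \<kappa> i)) = poly P (c \<kappa> + h) - poly P (c \<kappa>)"
    if "degree P \<le> k" for P
  proof -
    have "(poly (pderiv P) has_integral h * (\<Sum>i=1..n. w i * poly (pderiv P) (X \<kappa> i))) {c \<kappa>..c \<kappa> + h}"
      using rule that by (simp add: composite_rule_def degree_pderiv)
    moreover have "(poly (pderiv P) has_integral poly P (c \<kappa> + h) - poly P (c \<kappa>)) {c \<kappa>..c \<kappa> + h}"
      using h by (intro fundamental_theorem_of_calculus)
        (auto intro: has_field_derivative_at_within poly_DERIV simp flip: has_real_derivative_iff_has_vector_derivative)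
    ultimately show ?thesis by (rule has_integral_unique)
  qed
  obtain P where P: "degree P \<le> k" "(\<lambda>x. r (x, y)) = poly P"
    using bipoly_sections(1)[OF r, of y] by (auto simp: fun_eq_iff)
  have "grad r (x, y) $ 1 = poly (pderiv P) x" for x
    by (simp add: grad_def P(2) DERIV_imp_deriv[OF poly_DERIV])
  then show "h * (\<Sum>i=1..n. w i * grad r (X \<kappa> i, y) $ 1) = r (c \<kappa> + h, y) - r (c \<kappa>, y)"
    using *[OF P(1)] fun_cong[OF P(2)] by simp
  obtain Q where Q: "degree Q \<le> k" "(\<lambda>y. r (x, y)) = poly Q"
    using bipoly_sections(2)[OF r, of x] by (auto simp: fun_eq_iff)
  have "grad r (x, y) $ 2 = poly (pderiv Q) y" for y
    by (simp add: grad_def Q(2) DERIV_imp_deriv[OF poly_DERIV])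
  then show "h * (\<Sum>i=1..n. w i * grad r (x, X \<kappa> i) $ 2) = r (x, c \<kappa> + h) - r (x, c \<kappa>)"
    using *[OF Q(1)] fun_cong[OF Q(2)] by simp
qed

lemma Lim_one_sided:
  fixes f g :: "real \<Rightarrow> 'a::t2_space"
  assumes "continuous_on UNIV g"
  shows "(\<And>x. a < x \<Longrightarrow> x < b \<Longrightarrow> f x = g x) \<Longrightarrow> a < b \<Longrightarrow> Lim (at_right a) f = g a"
    "(\<And>x. b < x \<Longrightarrow> x < a \<Longrightarrow> f x = g x) \<Longrightarrow> b < a \<Longrightarrow> Lim (at_left a) f = g a"
proof -
  have g: "(g \<longlongrightarrow> g a) (at a within S)" for S
    using assms by (metis UNIV_I continuous_on_def tendsto_within_subset top_greatest)
  show "Lim (at_right a) f = g a" if "\<And>x. a < x \<Longrightarrow> x < b \<Longrightarrow> f x = g x" "a < b"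
  proof (rule tendsto_Lim[OF _ Lim_transform_eventually[OF g]])
    show "\<forall>\<^sub>F x in at_right a. g x = f x" using that by (auto simp: eventually_at_right_field)
  qed simp
  show "Lim (at_left a) f = g a" if "\<And>x. b < x \<Longrightarrow> x < a \<Longrightarrow> f x = g x" "b < a"
  proof (rule tendsto_Lim[OF _ Lim_transform_eventually[OF g]])
    show "\<forall>\<^sub>F x in at_left a. g x = f x" using that by (auto simp: eventually_at_left_field)
  qed simp
qed

context staggered_grid
begin

lemma half_simps [simp]: "half p 1 = p - 1" "half p (Suc 0) = p - 1" "half p 2 = p"
  by (simp_all add: half_def)

lemma grid_step_x: "gx G (p - 1) + dx G / 2 = gx G p" "gx G p + dx G / 2 = gx G (p + 1)"
  by (simp_all add: gx_def field_simps)

lemma grid_step_y: "gy G (q - 1) + dy G / 2 = gy G q" "gy G q + dy G / 2 = gy G (q + 1)"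
  by (simp_all add: gy_def field_simps)

lemma rule_points:
  assumes "x_rule p n v X" "y_rule q m w Y" "i \<in> {1..n}" "j \<in> {1..m}"
  shows "(X \<kappa> i, Y \<tau> j) \<in> closed_quarter p q \<kappa> \<tau>"
  using assms by (auto simp: composite_rule_def)

lemma integral_jump_halves:
  assumes J: "\<And>\<tau> s. \<tau> \<in> {1, 2} \<Longrightarrow> c \<tau> < s \<Longrightarrow> s < c \<tau> + h \<Longrightarrow> J s = r \<tau> s"
    and r: "\<And>\<tau>. \<tau> \<in> {1, 2} \<Longrightarrow> \<exists>P. degree P \<le> k \<and> (\<forall>s. r \<tau> s = poly P s)"
    and rule: "composite_rule k h c n w X" and h: "h > 0" and c: "c 2 = c 1 + h"
  shows "integral {c 1..c 2 + h} J = h * (\<Sum>\<tau>=1..2. \<Sum>j=1..n. w j * r \<tau> (X \<tau> j))"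
proof -
  have "(J has_integral h * (\<Sum>j=1..n. w j * r \<tau> (X \<tau> j))) {c \<tau>..c \<tau> + h}" if \<tau>: "\<tau> \<in> {1, 2}" for \<tau>
  proof -
    obtain P where P: "degree P \<le> k" "\<And>s. r \<tau> s = poly P s" using r[OF \<tau>] by blast
    then have "(poly P has_integral h * (\<Sum>j=1..n. w j * r \<tau> (X \<tau> j))) (cbox (c \<tau>) (c \<tau> + h))"
      using rule by (simp add: composite_rule_def)
    then have "(J has_integral h * (\<Sum>j=1..n. w j * r \<tau> (X \<tau> j))) (cbox (c \<tau>) (c \<tau> + h))"
      by (rule has_integral_spike_interior) (use J[OF \<tau>] P in auto)
    then show ?thesis by simp
  qed
  from this[of 1] this[of 2] have
    "(J has_integral h * (\<Sum>j=1..n. w j * r 1 (X 1 j)) + h * (\<Sum>j=1..n. w j * r 2 (X 2 j))) {c 1..c 2 + h}"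
    using h c by (intro has_integral_combine[of "c 1" "c 2"]) auto
  then show ?thesis by (simp add: integral_unique sum_quarters distrib_left)
qed

abbreviation gauss_mean where
  "gauss_mean p q \<equiv> tensor_mean (ngauss G) (gwt G) (xgauss G p) (ngauss G) (gwt G) (ygauss G q)"

text \<open>
  A discrete divergence theorem. On each quarter the volume sum of the derivative is the difference of
  the values on its two vertical sides; summing over the quarters, the outer sides give \<open>delta_x\<close> and the
  inner sides leave the jump across the midline.
\<close>
lemma pressure_jump_x:
  assumes f: "quarterwise_poly p q f"
  shows "dy G * delta_x G p q (trace G p q f) =
    dx G * dy G * gauss_mean p q (trace G p q (grad f)) $ 1 + jump_x G f p q"
proof -
  let ?N = "ngauss G" and ?w = "gwt G" and ?X = "xgauss G p" and ?Y = "ygauss G q"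
  obtain r where r: "\<And>\<kappa> \<tau>. \<kappa> \<in> {1, 2} \<Longrightarrow> \<tau> \<in> {1, 2} \<Longrightarrow> r \<kappa> \<tau> \<in> bipoly k"
    and fr: "\<And>\<kappa> \<tau> z. \<kappa> \<in> {1, 2} \<Longrightarrow> \<tau> \<in> {1, 2} \<Longrightarrow> z \<in> quarter G p q \<kappa> \<tau> \<Longrightarrow> f z = r \<kappa> \<tau> z"
    using f unfolding quarterwise_poly_def by metis
  \<comment> \<open>The Gauss mean of the pressure over a vertical line through quarter \<open>(\<kappa>, \<tau>)\<close>: the three terms
    of the claim are combinations of its values on the two faces and on the midline.\<close>
  define H where "H \<kappa> \<tau> x = (\<Sum>j=1..?N. ?w j * r \<kappa> \<tau> (x, ?Y \<tau> j))" for \<kappa> \<tau> x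
  have Y: "?Y \<tau> j \<in> {gy G (half q \<tau>)..gy G (half q \<tau>) + dy G / 2}" if "j \<in> {1..?N}" for \<tau> j
    using rules(2)[of q] that by (auto simp: composite_rule_def)
  have tr: "trace G p q f \<kappa> \<tau> (x, ?Y \<tau> j) = r \<kappa> \<tau> (x, ?Y \<tau> j)"
    if "\<kappa> \<in> {1, 2}" "\<tau> \<in> {1, 2}" "x \<in> {gx G (half p \<kappa>)..gx G (half p \<kappa>) + dx G / 2}" "j \<in> {1..?N}" for \<kappa> \<tau> x j
    using trace_eqI[OF _ fr[OF that(1,2)] continuous_on_bipoly[OF r[OF that(1,2)]]] Y that by simp

  have "trace G p q f 2 \<tau> (gx G (p + 1), ?Y \<tau> j) = r 2 \<tau> (gx G (p + 1), ?Y \<tau> j)"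
    "trace G p q f 1 \<tau> (gx G (p - 1), ?Y \<tau> j) = r 1 \<tau> (gx G (p - 1), ?Y \<tau> j)"
    if "\<tau> \<in> {1, 2}" "j \<in> {1..?N}" for \<tau> j
    using that dx grid_step_x[of p] tr[of 2 \<tau> "gx G (p + 1)" j] tr[of 1 \<tau> "gx G (p - 1)" j] by auto
  then have "delta_x G p q (trace G p q f) =
      (\<Sum>\<tau>=1..2. \<Sum>j=1..?N. (?w j / 2) *\<^sub>R (r 2 \<tau> (gx G (p + 1), ?Y \<tau> j) - r 1 \<tau> (gx G (p - 1), ?Y \<tau> j)))"
    unfolding delta_x_def halves by (intro sum.cong refl) simp
  also have "\<dots> = (\<Sum>\<tau>=1..2. H 2 \<tau> (gx G (p + 1)) - H 1 \<tau> (gx G (p - 1))) / 2"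
    by (simp add: H_def sum_divide_distrib right_diff_distrib sum_subtractf diff_divide_distrib)
  finally have d: "delta_x G p q (trace G p q f) = (\<Sum>\<tau>=1..2. H 2 \<tau> (gx G (p + 1)) - H 1 \<tau> (gx G (p - 1))) / 2" .

  have "gauss_mean p q (trace G p q (grad f)) $ 1 = gauss_mean p q (\<lambda>\<kappa> \<tau> z. grad (r \<kappa> \<tau>) z) $ 1"
    by (intro arg_cong[of _ _ "\<lambda>v. v $ 1"] tensor_mean_cong trace_grad_eqI rule_points[OF rules(1,2)] fr r)
  also have "\<dots> = gauss_mean p q (\<lambda>\<kappa> \<tau> z. grad (r \<kappa> \<tau>) z $ 1)"
    by (rule tensor_mean_linear) (simp add: linear_iff)
  also have "\<dots> = (\<Sum>\<kappa>=1..2. \<Sum>\<tau>=1..2. \<Sum>j=1..?N. \<Sum>i=1..?N. ?w i * ?w j * grad (r \<kappa> \<tau>) (?X \<kappa> i, ?Y \<tau> j) $ 1) / 4"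
    unfolding tensor_mean_swap by simp
  finally have m: "gauss_mean p q (trace G p q (grad f)) $ 1 = \<dots>" .
  have "dx G / 2 * gauss_mean p q (trace G p q (grad f)) $ 1 = (\<Sum>\<kappa>=1..2. \<Sum>\<tau>=1..2. \<Sum>j=1..?N. ?w j *
      (dx G / 2 * (\<Sum>i=1..?N. ?w i * grad (r \<kappa> \<tau>) (?X \<kappa> i, ?Y \<tau> j) $ 1))) / 4"
    unfolding m by (simp add: sum_distrib_left sum_divide_distrib mult_ac)
  also have "\<dots> = (\<Sum>\<kappa>=1..2. \<Sum>\<tau>=1..2. \<Sum>j=1..?N. ?w j *
      (r \<kappa> \<tau> (gx G (half p \<kappa>) + dx G / 2, ?Y \<tau> j) - r \<kappa> \<tau> (gx G (half p \<kappa>), ?Y \<tau> j))) / 4"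
    by (intro arg_cong[of _ _ "\<lambda>s. s / 4"] sum.cong arg_cong2[of _ _ _ _ "(*)"] refl
        rule_integrates_partials(1)[OF rules(1)] r) (use dx in \<open>auto simp: halves\<close>)
  also have "\<dots> = (\<Sum>\<kappa>=1..2. \<Sum>\<tau>=1..2. H \<kappa> \<tau> (gx G (half p \<kappa>) + dx G / 2) - H \<kappa> \<tau> (gx G (half p \<kappa>))) / 4"
    by (simp add: H_def right_diff_distrib sum_subtractf)
  finally have g: "dx G / 2 * gauss_mean p q (trace G p q (grad f)) $ 1 =
    (\<Sum>\<kappa>=1..2. \<Sum>\<tau>=1..2. H \<kappa> \<tau> (gx G (half p \<kappa>) + dx G / 2) - H \<kappa> \<tau> (gx G (half p \<kappa>))) / 4" .

  have J: "Lim (at_right (gx G p)) (\<lambda>x. f (x, y)) - Lim (at_left (gx G p)) (\<lambda>x. f (x, y)) =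
      r 2 \<tau> (gx G p, y) - r 1 \<tau> (gx G p, y)"
    if \<tau>: "\<tau> \<in> {1, 2}" and y: "gy G (half q \<tau>) < y" "y < gy G (half q \<tau>) + dy G / 2" for \<tau> y
  proof -
    have c: "continuous_on UNIV (\<lambda>x. r \<kappa> \<tau> (x, y))" if "\<kappa> \<in> {1, 2}" for \<kappa>
      by (intro continuous_on_compose2[OF continuous_on_bipoly[OF r[OF that \<tau>], of UNIV]] continuous_intros) auto
    have "Lim (at_right (gx G p)) (\<lambda>x. f (x, y)) = r 2 \<tau> (gx G p, y)"
      using \<tau> y dx by (intro Lim_one_sided(1)[OF c, where b = "gx G p + dx G / 2"] fr) (auto simp: quarter_eq)
    moreover have "Lim (at_left (gx G p)) (\<lambda>x. f (x, y)) = r 1 \<tau> (gx G p, y)"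
      using \<tau> y dx grid_step_x[of p]
      by (intro Lim_one_sided(2)[OF c, where b = "gx G (p - 1)"] fr) (auto simp: quarter_eq)
    ultimately show ?thesis by simp
  qed
  have P: "\<exists>P. degree P \<le> k \<and> (\<forall>y. r 2 \<tau> (gx G p, y) - r 1 \<tau> (gx G p, y) = poly P y)" if \<tau>: "\<tau> \<in> {1, 2}" for \<tau>
  proof -
    have "\<exists>P. degree P \<le> k \<and> (\<forall>y. r \<kappa> \<tau> (gx G p, y) = poly P y)" if "\<kappa> \<in> {1, 2}" for \<kappa>
      by (rule bipoly_sections(2)[OF r[OF that \<tau>]])
    from this[of 2] this[of 1] obtain P Q where "degree P \<le> k" "\<forall>y. r 2 \<tau> (gx G p, y) = poly P y"
      "degree Q \<le> k" "\<forall>y. r 1 \<tau> (gx G p, y) = poly Q y" by auto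
    then show ?thesis by (intro exI[of _ "P - Q"]) (simp add: degree_diff_le)
  qed
  have j: "jump_x G f p q = dy G / 2 * (\<Sum>\<tau>=1..2. H 2 \<tau> (gx G p) - H 1 \<tau> (gx G p))"
    using integral_jump_halves[where c = "\<lambda>\<tau>. gy G (half q \<tau>)" and
        r = "\<lambda>\<tau> y. r 2 \<tau> (gx G p, y) - r 1 \<tau> (gx G p, y)", OF J P rules(2)] dy grid_step_y[of q]
    by (simp add: jump_x_def H_def right_diff_distrib sum_subtractf)
  have "dx G * dy G * gauss_mean p q (trace G p q (grad f)) $ 1 =
    2 * dy G * (dx G / 2 * gauss_mean p q (trace G p q (grad f)) $ 1)" by simp
  then show ?thesis unfolding d g j by (simp add: sum_quarters grid_step_x grid_step_y field_simps)
qed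

lemma pressure_jump_y:
  assumes f: "quarterwise_poly p q f"
  shows "dx G * delta_y G p q (trace G p q f) =
    dx G * dy G * gauss_mean p q (trace G p q (grad f)) $ 2 + jump_y G f p q"
proof -
  let ?N = "ngauss G" and ?w = "gwt G" and ?X = "xgauss G p" and ?Y = "ygauss G q"
  obtain r where r: "\<And>\<kappa> \<tau>. \<kappa> \<in> {1, 2} \<Longrightarrow> \<tau> \<in> {1, 2} \<Longrightarrow> r \<kappa> \<tau> \<in> bipoly k"
    and fr: "\<And>\<kappa> \<tau> z. \<kappa> \<in> {1, 2} \<Longrightarrow> \<tau> \<in> {1, 2} \<Longrightarrow> z \<in> quarter G p q \<kappa> \<tau> \<Longrightarrow> f z = r \<kappa> \<tau> z"
    using f unfolding quarterwise_poly_def by metis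
  define H where "H \<kappa> \<tau> y = (\<Sum>i=1..?N. ?w i * r \<kappa> \<tau> (?X \<kappa> i, y))" for \<kappa> \<tau> y
  have X: "?X \<kappa> i \<in> {gx G (half p \<kappa>)..gx G (half p \<kappa>) + dx G / 2}" if "i \<in> {1..?N}" for \<kappa> i
    using rules(1)[of p] that by (auto simp: composite_rule_def)
  have tr: "trace G p q f \<kappa> \<tau> (?X \<kappa> i, y) = r \<kappa> \<tau> (?X \<kappa> i, y)"
    if "\<kappa> \<in> {1, 2}" "\<tau> \<in> {1, 2}" "y \<in> {gy G (half q \<tau>)..gy G (half q \<tau>) + dy G / 2}" "i \<in> {1..?N}" for \<kappa> \<tau> y i
    using trace_eqI[OF _ fr[OF that(1,2)] continuous_on_bipoly[OF r[OF that(1,2)]]] X that by simp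

  have "trace G p q f \<kappa> 2 (?X \<kappa> i, gy G (q + 1)) = r \<kappa> 2 (?X \<kappa> i, gy G (q + 1))"
    "trace G p q f \<kappa> 1 (?X \<kappa> i, gy G (q - 1)) = r \<kappa> 1 (?X \<kappa> i, gy G (q - 1))"
    if "\<kappa> \<in> {1, 2}" "i \<in> {1..?N}" for \<kappa> i
    using that dy grid_step_y[of q] tr[of \<kappa> 2 "gy G (q + 1)" i] tr[of \<kappa> 1 "gy G (q - 1)" i] by auto
  then have "delta_y G p q (trace G p q f) =
      (\<Sum>\<kappa>=1..2. \<Sum>i=1..?N. (?w i / 2) *\<^sub>R (r \<kappa> 2 (?X \<kappa> i, gy G (q + 1)) - r \<kappa> 1 (?X \<kappa> i, gy G (q - 1))))"
    unfolding delta_y_def halves by (intro sum.cong refl) simp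
  also have "\<dots> = (\<Sum>\<kappa>=1..2. H \<kappa> 2 (gy G (q + 1)) - H \<kappa> 1 (gy G (q - 1))) / 2"
    by (simp add: H_def sum_divide_distrib right_diff_distrib sum_subtractf diff_divide_distrib)
  finally have d: "delta_y G p q (trace G p q f) = (\<Sum>\<kappa>=1..2. H \<kappa> 2 (gy G (q + 1)) - H \<kappa> 1 (gy G (q - 1))) / 2" .

  have "gauss_mean p q (trace G p q (grad f)) $ 2 = gauss_mean p q (\<lambda>\<kappa> \<tau> z. grad (r \<kappa> \<tau>) z) $ 2"
    by (intro arg_cong[of _ _ "\<lambda>v. v $ 2"] tensor_mean_cong trace_grad_eqI rule_points[OF rules(1,2)] fr r)
  also have "\<dots> = gauss_mean p q (\<lambda>\<kappa> \<tau> z. grad (r \<kappa> \<tau>) z $ 2)"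
    by (rule tensor_mean_linear) (simp add: linear_iff)
  finally have m: "gauss_mean p q (trace G p q (grad f)) $ 2 = \<dots>" .
  have "dy G / 2 * gauss_mean p q (trace G p q (grad f)) $ 2 = (\<Sum>\<kappa>=1..2. \<Sum>\<tau>=1..2. \<Sum>i=1..?N. ?w i *
      (dy G / 2 * (\<Sum>j=1..?N. ?w j * grad (r \<kappa> \<tau>) (?X \<kappa> i, ?Y \<tau> j) $ 2))) / 4"
    unfolding m by (simp add: tensor_mean_def sum_distrib_left sum_divide_distrib mult_ac)
  also have "\<dots> = (\<Sum>\<kappa>=1..2. \<Sum>\<tau>=1..2. \<Sum>i=1..?N. ?w i *
      (r \<kappa> \<tau> (?X \<kappa> i, gy G (half q \<tau>) + dy G / 2) - r \<kappa> \<tau> (?X \<kappa> i, gy G (half q \<tau>)))) / 4"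
    by (intro arg_cong[of _ _ "\<lambda>s. s / 4"] sum.cong arg_cong2[of _ _ _ _ "(*)"] refl
        rule_integrates_partials(2)[OF rules(2)] r) (use dy in \<open>auto simp: halves\<close>)
  also have "\<dots> = (\<Sum>\<kappa>=1..2. \<Sum>\<tau>=1..2. H \<kappa> \<tau> (gy G (half q \<tau>) + dy G / 2) - H \<kappa> \<tau> (gy G (half q \<tau>))) / 4"
    by (simp add: H_def right_diff_distrib sum_subtractf)
  finally have g: "dy G / 2 * gauss_mean p q (trace G p q (grad f)) $ 2 =
    (\<Sum>\<kappa>=1..2. \<Sum>\<tau>=1..2. H \<kappa> \<tau> (gy G (half q \<tau>) + dy G / 2) - H \<kappa> \<tau> (gy G (half q \<tau>))) / 4" .

  have J: "Lim (at_right (gy G q)) (\<lambda>y. f (x, y)) - Lim (at_left (gy G q)) (\<lambda>y. f (x, y)) =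
      r \<kappa> 2 (x, gy G q) - r \<kappa> 1 (x, gy G q)"
    if \<kappa>: "\<kappa> \<in> {1, 2}" and x: "gx G (half p \<kappa>) < x" "x < gx G (half p \<kappa>) + dx G / 2" for \<kappa> x
  proof -
    have c: "continuous_on UNIV (\<lambda>y. r \<kappa> \<tau> (x, y))" if "\<tau> \<in> {1, 2}" for \<tau>
      by (intro continuous_on_compose2[OF continuous_on_bipoly[OF r[OF \<kappa> that], of UNIV]] continuous_intros) auto
    have "Lim (at_right (gy G q)) (\<lambda>y. f (x, y)) = r \<kappa> 2 (x, gy G q)"
      using \<kappa> x dy by (intro Lim_one_sided(1)[OF c, where b = "gy G q + dy G / 2"] fr) (auto simp: quarter_eq)
    moreover have "Lim (at_left (gy G q)) (\<lambda>y. f (x, y)) = r \<kappa> 1 (x, gy G q)"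
      using \<kappa> x dy grid_step_y[of q]
      by (intro Lim_one_sided(2)[OF c, where b = "gy G (q - 1)"] fr) (auto simp: quarter_eq)
    ultimately show ?thesis by simp
  qed
  have P: "\<exists>P. degree P \<le> k \<and> (\<forall>x. r \<kappa> 2 (x, gy G q) - r \<kappa> 1 (x, gy G q) = poly P x)" if \<kappa>: "\<kappa> \<in> {1, 2}" for \<kappa>
  proof -
    have "\<exists>P. degree P \<le> k \<and> (\<forall>x. r \<kappa> \<tau> (x, gy G q) = poly P x)" if "\<tau> \<in> {1, 2}" for \<tau>
      by (rule bipoly_sections(1)[OF r[OF \<kappa> that]])
    from this[of 2] this[of 1] obtain P Q where "degree P \<le> k" "\<forall>x. r \<kappa> 2 (x, gy G q) = poly P x"
      "degree Q \<le> k" "\<forall>x. r \<kappa> 1 (x, gy G q) = poly Q x" by auto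
    then show ?thesis by (intro exI[of _ "P - Q"]) (simp add: degree_diff_le)
  qed
  have j: "jump_y G f p q = dx G / 2 * (\<Sum>\<kappa>=1..2. H \<kappa> 2 (gy G q) - H \<kappa> 1 (gy G q))"
    using integral_jump_halves[where c = "\<lambda>\<kappa>. gx G (half p \<kappa>)" and
        r = "\<lambda>\<kappa> x. r \<kappa> 2 (x, gy G q) - r \<kappa> 1 (x, gy G q)", OF J P rules(1)] dx grid_step_x[of p]
    by (simp add: jump_y_def H_def right_diff_distrib sum_subtractf)
  have "dx G * dy G * gauss_mean p q (trace G p q (grad f)) $ 2 =
    2 * dx G * (dy G / 2 * gauss_mean p q (trace G p q (grad f)) $ 2)" by simp
  then show ?thesis unfolding d g j by (simp add: sum_quarters grid_step_x grid_step_y field_simps)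
qed

end

section \<open>Decomposition of the cell average\<close>

lemma tensor_mean_adm_cone:
  assumes "\<And>i. i \<in> {1..n} \<Longrightarrow> v i \<ge> 0" "\<And>j. j \<in> {1..m} \<Longrightarrow> w j \<ge> 0"
    and "\<And>\<kappa> \<tau> i j. \<kappa> \<in> {1, 2} \<Longrightarrow> \<tau> \<in> {1, 2} \<Longrightarrow> i \<in> {1..n} \<Longrightarrow> j \<in> {1..m} \<Longrightarrow>
      F \<kappa> \<tau> (X \<kappa> i, Y \<tau> j) \<in> adm_cone"
  shows "tensor_mean n v X m w Y F \<in> adm_cone"
  unfolding tensor_mean_def halves using assms
  by (intro adm_cone_scaleR adm_cone_sum) auto

text \<open>
  Weights may vanish here, but as they add up to one, some point of every quarter carries a positive
  weight.
\<close>
lemma tensor_mean_pos: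
  fixes F :: "nat \<Rightarrow> nat \<Rightarrow> real \<times> real \<Rightarrow> real"
  assumes v: "\<And>i. i \<in> {1..n} \<Longrightarrow> v i \<ge> 0" "sum v {1..n} = 1"
    and w: "\<And>j. j \<in> {1..m} \<Longrightarrow> w j \<ge> 0" "sum w {1..m} = 1"
    and F: "\<And>\<kappa> \<tau> i j. \<kappa> \<in> {1, 2} \<Longrightarrow> \<tau> \<in> {1, 2} \<Longrightarrow> i \<in> {1..n} \<Longrightarrow> j \<in> {1..m} \<Longrightarrow>
      F \<kappa> \<tau> (X \<kappa> i, Y \<tau> j) > 0"
  shows "tensor_mean n v X m w Y F > 0"
proof -
  have "\<exists>i\<in>{1..n}. v i \<noteq> 0" "\<exists>j\<in>{1..m}. w j \<noteq> 0"
    using v(2) w(2) by (metis sum.neutral zero_neq_one)+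
  then obtain i j where i: "i \<in> {1..n}" "v i > 0" and j: "j \<in> {1..m}" "w j > 0"
    using v(1) w(1) by (metis less_eq_real_def)
  have "(\<Sum>i=1..n. \<Sum>j=1..m. v i * w j * F \<kappa> \<tau> (X \<kappa> i, Y \<tau> j)) > 0"
    if "\<kappa> \<in> {1, 2}" "\<tau> \<in> {1, 2}" for \<kappa> \<tau>
    using i j v(1) w(1) F[OF that]
    by (intro sum_pos2[of _ i] sum_pos2[of _ j] mult_pos_pos sum_nonneg mult_nonneg_nonneg)
      (auto intro: less_imp_le)
  from this[of 1 1] this[of 1 2] this[of 2 1] this[of 2 2] show ?thesis
    by (simp add: tensor_mean_def sum_quarters)
qed

lemma linear_moving_energy: "linear (moving_energy a b)"
  by (rule linearI) (simp_all add: moving_energy_add moving_energy_scaleR)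

lemma tensor_mean_admissible:
  assumes "\<gamma> > 1" "\<And>i. i \<in> {1..n} \<Longrightarrow> v i \<ge> 0" "sum v {1..n} = 1"
    "\<And>j. j \<in> {1..m} \<Longrightarrow> w j \<ge> 0" "sum w {1..m} = 1"
    and F: "\<And>\<kappa> \<tau> i j. \<kappa> \<in> {1, 2} \<Longrightarrow> \<tau> \<in> {1, 2} \<Longrightarrow> i \<in> {1..n} \<Longrightarrow> j \<in> {1..m} \<Longrightarrow>
      F \<kappa> \<tau> (X \<kappa> i, Y \<tau> j) \<in> admissible \<gamma>"
  shows "tensor_mean n v X m w Y F \<in> admissible \<gamma>"
proof -
  have density: "linear (\<lambda>U :: real ^ 4. U $ 1)" by (simp add: linear_iff)
  have "tensor_mean n v X m w Y F $ 1 > 0"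
    unfolding tensor_mean_linear[OF density]
    by (rule tensor_mean_pos) (use assms in \<open>auto simp: admissible_def\<close>)
  moreover have "moving_energy a b (tensor_mean n v X m w Y F) > 0" for a b
    unfolding tensor_mean_linear[OF linear_moving_energy]
    by (rule tensor_mean_pos) (use assms in \<open>auto simp: admissible_iff_moving_energy\<close>)
  ultimately show ?thesis using assms(1) by (simp add: admissible_iff_moving_energy)
qed

lemma composite_rule_weights_sum:
  assumes "composite_rule k h c n w X" "h > 0"
  shows "sum w {1..n} = 1"
proof -
  have "(poly 1 has_integral h * (\<Sum>i=1..n. w i * poly 1 (X 1 i))) {c 1..c 1 + h}"
    using assms(1) unfolding composite_rule_def by (metis degree_1 le0)
  moreover have "(poly 1 has_integral h) {c 1..c 1 + h}"
    using has_integral_const_real[of "1::real" "c 1" "c 1 + h"] assms(2) by (simp add: poly_1[abs_def])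
  ultimately have "h * (\<Sum>i=1..n. w i * poly 1 (X 1 i)) = h" by (rule has_integral_unique)
  then show ?thesis using assms(2) by simp
qed

text \<open>
  One line of quadrature points across the cell in the direction of the flux: \<open>U\<close> on the first half,
  \<open>V\<close> on the second, with the fluxes \<open>F\<^sub>1\<close> and \<open>F\<^sub>2\<close> at its two ends. The relation between \<open>c\<close> and \<open>l\<close>
  makes the share of an end value in the mean exactly what is needed to absorb the flux there; all other
  points are in the cone anyway.
\<close>
lemma two_halves_flux_cone:
  fixes w :: "nat \<Rightarrow> real"
  assumes w: "\<And>i. i \<in> {1..n} \<Longrightarrow> w i \<ge> 0" "w n = w 1" "n \<ge> 1"
    and U: "\<And>i. i \<in> {1..n} \<Longrightarrow> U i \<in> adm_cone" "\<And>i. i \<in> {1..n} \<Longrightarrow> V i \<in> adm_cone"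
    and c: "c \<ge> 0" "l \<ge> 0" "c * w 1 = l * a"
    and F: "a *\<^sub>R U 1 + F\<^sub>1 \<in> adm_cone" "a *\<^sub>R V n - F\<^sub>2 \<in> adm_cone"
  shows "c *\<^sub>R (\<Sum>i=1..n. w i *\<^sub>R (U i + V i)) - l *\<^sub>R (F\<^sub>2 - F\<^sub>1) \<in> adm_cone"
proof -
  have "1 \<in> {1..n}" "n \<in> {1..n}" using w(3) by auto
  from sum.remove[OF finite_atLeastAtMost this(1), of "\<lambda>i. w i *\<^sub>R U i"]
    sum.remove[OF finite_atLeastAtMost this(2), of "\<lambda>i. w i *\<^sub>R V i"]
  have s: "(\<Sum>i=1..n. w i *\<^sub>R U i) = w 1 *\<^sub>R U 1 + (\<Sum>i\<in>{1..n} - {1}. w i *\<^sub>R U i)"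
    "(\<Sum>i=1..n. w i *\<^sub>R V i) = w 1 *\<^sub>R V n + (\<Sum>i\<in>{1..n} - {n}. w i *\<^sub>R V i)"
    unfolding w(2) .
  have "c *\<^sub>R (\<Sum>i=1..n. w i *\<^sub>R (U i + V i)) - l *\<^sub>R (F\<^sub>2 - F\<^sub>1) =
      l *\<^sub>R (a *\<^sub>R U 1 + F\<^sub>1) + l *\<^sub>R (a *\<^sub>R V n - F\<^sub>2) +
      c *\<^sub>R ((\<Sum>i\<in>{1..n} - {1}. w i *\<^sub>R U i) + (\<Sum>i\<in>{1..n} - {n}. w i *\<^sub>R V i))"
    by (simp only: scaleR_add_right sum.distrib s) (simp add: algebra_simps c(3)[unfolded One_nat_def])
  also have "\<dots> \<in> adm_cone"
  proof (intro adm_cone_add)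
    show "l *\<^sub>R (a *\<^sub>R U 1 + F\<^sub>1) \<in> adm_cone" "l *\<^sub>R (a *\<^sub>R V n - F\<^sub>2) \<in> adm_cone"
      by (rule adm_cone_scaleR[OF _ c(2)], rule F)+
    have "(\<Sum>i\<in>{1..n} - {1}. w i *\<^sub>R U i) + (\<Sum>i\<in>{1..n} - {n}. w i *\<^sub>R V i) \<in> adm_cone"
      using w U by (intro adm_cone_add adm_cone_sum adm_cone_scaleR) auto
    then show "c *\<^sub>R ((\<Sum>i\<in>{1..n} - {1}. w i *\<^sub>R U i) + (\<Sum>i\<in>{1..n} - {n}. w i *\<^sub>R V i)) \<in> adm_cone"
      by (rule adm_cone_scaleR[OF _ c(1)])
  qed
  finally show ?thesis .
qed

context staggered_grid
begin

definition quarterwise_state :: "int \<Rightarrow> int \<Rightarrow> (real \<times> real \<Rightarrow> real ^ 4) \<Rightarrow> bool" where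
  "quarterwise_state p q U \<longleftrightarrow> (\<forall>i. quarterwise_poly p q (\<lambda>z. U z $ i))"

lemma trace_component:
  assumes U: "quarterwise_state p q U" and \<kappa>\<tau>: "\<kappa> \<in> {1, 2}" "\<tau> \<in> {1, 2}"
    and z: "z \<in> closed_quarter p q \<kappa> \<tau>"
  shows "trace G p q U \<kappa> \<tau> z $ i = trace G p q (\<lambda>z. U z $ i) \<kappa> \<tau> z"
proof -
  have "\<exists>r. r \<in> bipoly k \<and> (\<forall>z\<in>quarter G p q \<kappa> \<tau>. U z $ i = r z)" for i
    using U \<kappa>\<tau> unfolding quarterwise_state_def quarterwise_poly_def by blast
  then obtain r where r: "\<And>i. r i \<in> bipoly k" and Ur: "\<And>i z. z \<in> quarter G p q \<kappa> \<tau> \<Longrightarrow> U z $ i = r i z"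
    by metis
  have "trace G p q U \<kappa> \<tau> z = (\<chi> i. r i z)"
    by (rule trace_eqI[OF z]) (auto simp: vec_eq_iff Ur intro!: continuous_on_vec_lambda continuous_on_bipoly r)
  moreover have "trace G p q (\<lambda>z. U z $ i) \<kappa> \<tau> z = r i z"
    by (rule trace_eqI[OF z Ur continuous_on_bipoly[OF r]])
  ultimately show ?thesis by simp
qed

lemma cell_average_tensor:
  assumes U: "quarterwise_state p q U" and X: "x_rule p n v X" and Y: "y_rule q m w Y"
  shows "U integrable_on cell G p q" "cell_avg G p q U = tensor_mean n v X m w Y (trace G p q U)"
proof -
  have comp: "((\<lambda>z. U z $ i) has_integral (dx G * dy G) * tensor_mean n v X m w Y (trace G p q U) $ i) (cell G p q)" for i
  proof -
    have "tensor_mean n v X m w Y (trace G p q U) $ i = tensor_mean n v X m w Y (\<lambda>\<kappa> \<tau> z. trace G p q U \<kappa> \<tau> z $ i)"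
      by (rule tensor_mean_linear) (simp add: linear_iff)
    also have "\<dots> = tensor_mean n v X m w Y (trace G p q (\<lambda>z. U z $ i))"
      by (intro tensor_mean_cong trace_component U rule_points[OF X Y])
    finally show ?thesis
      using has_integral_cell_tensor[OF _ X Y, of "\<lambda>z. U z $ i"] U by (simp add: quarterwise_state_def)
  qed
  have "(U has_integral (dx G * dy G) *\<^sub>R tensor_mean n v X m w Y (trace G p q U)) (cell G p q)"
    by (subst has_integral_componentwise_iff) (use comp in \<open>auto simp: Basis_vec_def inner_axis\<close>)
  then show "U integrable_on cell G p q" "cell_avg G p q U = tensor_mean n v X m w Y (trace G p q U)"
    using dx dy by (auto simp: cell_avg_def integral_unique)
qed

lemma cell_average_Qmat:
  assumes "quarterwise_state p q U"
  shows "cell_avg G p q (\<lambda>z. Qmat (U z)) = Qmat (cell_avg G p q U)"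
  using integral_linear[OF cell_average_tensor(1)[OF assms rules(1,2)], of Qmat] linear_Qmat
  by (simp add: cell_avg_def o_def linear_scale linear_conv_bounded_linear)

text \<open>
  The discrete source contains the volume term with \<open>Q / \<rho> - R\<close> and the face term with \<open>R\<close>. By the
  discrete divergence theorem the two occurrences of the pressure gradient under the constant matrix \<open>R\<close>
  cancel, and \<open>R\<close> is left multiplied by the jumps. As \<open>R\<close> is the average of \<open>Q\<close> divided by that of
  \<open>\<rho>\<close>, this term too is a Gauss mean of \<open>Q\<close> applied to a vector, which is the second summand of
  \<open>grad_phi_hat\<close>.
\<close>
lemma source_eq:
  assumes U: "quarterwise_state p q U" and f: "quarterwise_poly p q f"
  shows "source G U \<rho> f p q = - (dx G * dy G) *\<^sub>R
    gauss_mean p q (\<lambda>\<kappa> \<tau> z. Qmat (trace G p q U \<kappa> \<tau> z) *v grad_phi_hat G \<rho> f p q \<kappa> \<tau> z)"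
proof -
  define R where "R = Rmat G U \<rho> p q"
  define g where "g = trace G p q (grad f)"
  define Q where "Q \<kappa> \<tau> z = Qmat (trace G p q U \<kappa> \<tau> z)" for \<kappa> \<tau> z
  define s where "s \<kappa> \<tau> z = (1 / trace G p q \<rho> \<kappa> \<tau> z) *\<^sub>R g \<kappa> \<tau> z" for \<kappa> \<tau> z
  define J :: "real ^ 2" where "J = vector [jump_x G f p q, jump_y G f p q]"
  define a where "a = cell_avg G p q \<rho>"
  let ?A = "dx G * dy G"
  have lin: "linear (\<lambda>u. Qmat u *v c)" for c
    using linear_Qmat by (intro linearI) (simp_all add: linear_add linear_scale matrix_vector_mult_add_rdistrib scaleR_matrix_vector_assoc)
  have RJ: "R *v J = gauss_mean p q (\<lambda>\<kappa> \<tau> z. Q \<kappa> \<tau> z *v ((1 / a) *\<^sub>R J))"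
  proof -
    have "R *v J = Qmat (gauss_mean p q (trace G p q U)) *v ((1 / a) *\<^sub>R J)"
      by (simp add: R_def Rmat_def cell_average_Qmat[OF U] cell_average_tensor(2)[OF U rules(1,2)] a_def
          flip: scaleR_matrix_vector_assoc matrix_vector_mult_scaleR)
    then show ?thesis by (simp only: tensor_mean_linear[OF lin] Q_def)
  qed
  have B: "vector [dy G * delta_x G p q (trace G p q f), dx G * delta_y G p q (trace G p q f)] =
      ?A *\<^sub>R gauss_mean p q g + J"
    using pressure_jump_x[OF f] pressure_jump_y[OF f] by (simp add: vec_eq_iff forall_2 J_def g_def)
  have Rg: "R *v gauss_mean p q g = gauss_mean p q (\<lambda>\<kappa> \<tau> z. R *v g \<kappa> \<tau> z)"
    by (rule tensor_mean_linear) (simp add: matrix_vector_mul_linear)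
  have neg: "M *v (- x) = - (M *v x)" for M :: "real ^ 2 ^ 4" and x
    using matrix_vector_mult_scaleR[of M "-1" x] by simp
  have "source G U \<rho> f p q = ?A *\<^sub>R gauss_mean p q (\<lambda>\<kappa> \<tau> z.
      ((1 / trace G p q \<rho> \<kappa> \<tau> z) *\<^sub>R Q \<kappa> \<tau> z - R) *v g \<kappa> \<tau> z) + R *v (?A *\<^sub>R gauss_mean p q g + J)"
    unfolding B[symmetric] unfolding source_def g_def Q_def by (simp add: tensor_mean_def Let_def R_def)
  also have "(\<lambda>\<kappa> \<tau> z. ((1 / trace G p q \<rho> \<kappa> \<tau> z) *\<^sub>R Q \<kappa> \<tau> z - R) *v g \<kappa> \<tau> z) =
      (\<lambda>\<kappa> \<tau> z. Q \<kappa> \<tau> z *v s \<kappa> \<tau> z + (-1) *\<^sub>R (R *v g \<kappa> \<tau> z))"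
    by (simp add: fun_eq_iff s_def matrix_vector_mult_diff_rdistrib matrix_vector_mult_scaleR
        flip: scaleR_matrix_vector_assoc)
  also have "gauss_mean p q \<dots> = gauss_mean p q (\<lambda>\<kappa> \<tau> z. Q \<kappa> \<tau> z *v s \<kappa> \<tau> z) + (-1) *\<^sub>R (R *v gauss_mean p q g)"
    unfolding tensor_mean_add Rg
    by (subst tensor_mean_linear[of "\<lambda>v. (-1) *\<^sub>R v"]) (auto simp: linear_iff)
  finally have "source G U \<rho> f p q = ?A *\<^sub>R gauss_mean p q (\<lambda>\<kappa> \<tau> z. Q \<kappa> \<tau> z *v s \<kappa> \<tau> z) + R *v J"
    by (simp add: matrix_vector_right_distrib matrix_vector_mult_scaleR scaleR_diff_right)
  also have "R *v J = ?A *\<^sub>R gauss_mean p q (\<lambda>\<kappa> \<tau> z. Q \<kappa> \<tau> z *v ((1 / (a * dx G * dy G)) *\<^sub>R J))"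
    unfolding RJ using dx dy
    by (subst tensor_mean_linear[of "\<lambda>v. ?A *\<^sub>R v"]) (auto simp: linear_iff scaleR_add_right matrix_vector_mult_scaleR)
  also have "?A *\<^sub>R gauss_mean p q (\<lambda>\<kappa> \<tau> z. Q \<kappa> \<tau> z *v s \<kappa> \<tau> z) + \<dots> =
      ?A *\<^sub>R gauss_mean p q (\<lambda>\<kappa> \<tau> z. Q \<kappa> \<tau> z *v s \<kappa> \<tau> z + Q \<kappa> \<tau> z *v ((1 / (a * dx G * dy G)) *\<^sub>R J))"
    by (simp add: tensor_mean_add scaleR_add_right)
  also have "(\<lambda>\<kappa> \<tau> z. Q \<kappa> \<tau> z *v s \<kappa> \<tau> z + Q \<kappa> \<tau> z *v ((1 / (a * dx G * dy G)) *\<^sub>R J)) =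
      (\<lambda>\<kappa> \<tau> z. (-1) *\<^sub>R (Q \<kappa> \<tau> z *v grad_phi_hat G \<rho> f p q \<kappa> \<tau> z))"
    by (simp add: fun_eq_iff grad_phi_hat_def s_def g_def J_def a_def matrix_vector_mult_diff_distrib
        neg)
  also have "gauss_mean p q \<dots> = (-1) *\<^sub>R gauss_mean p q (\<lambda>\<kappa> \<tau> z. Q \<kappa> \<tau> z *v grad_phi_hat G \<rho> f p q \<kappa> \<tau> z)"
    by (subst tensor_mean_linear[of "\<lambda>v. (-1) *\<^sub>R v"]) (auto simp: linear_iff)
  finally show ?thesis by (simp add: Q_def)
qed

lemma weights_nonneg:
  "i \<in> {1..ngauss G} \<Longrightarrow> gwt G i \<ge> 0" "i \<in> {1..nlob G} \<Longrightarrow> lwt G i \<ge> 0" "lwt G (nlob G) = lwt G 1"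
proof -
  have "nlob G \<ge> 2" using lob_points by linarith
  then show "i \<in> {1..ngauss G} \<Longrightarrow> gwt G i \<ge> 0" "i \<in> {1..nlob G} \<Longrightarrow> lwt G i \<ge> 0"
    "lwt G (nlob G) = lwt G 1"
    using gauss_weight_nonneg[OF gauss] lobatto_weight_nonneg[OF lobatto]
      lobatto_endpoint_weights_eq[OF lobatto] by auto
qed

lemma lobatto_endpoints:
  "xlob G p 1 1 = gx G (p - 1)" "xlob G p 2 (nlob G) = gx G (p + 1)"
  "ylob G q 1 1 = gy G (q - 1)" "ylob G q 2 (nlob G) = gy G (q + 1)"
  using lobatto by (auto simp: xlob_def ylob_def gauss_lobatto_rule_def gx_def gy_def field_simps)

text \<open>
  Taking the Gauss--Lobatto rule across the cell in \<open>x\<close> puts quadrature points on the vertical faces,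
  where the flux is evaluated at the same Gauss points in \<open>y\<close>. Thus the claim splits into one instance of
  \<open>two_halves_flux_cone\<close> for every horizontal line of points. The factor 2 comes from the share \<open>1/4\<close> of a
  quarter in the mean against the share \<open>1/2\<close> of half a face in \<open>delta_x\<close>.
\<close>
lemma flux_x_cone:
  assumes \<gamma>: "\<gamma> > 1" and U: "quarterwise_state p q U" and adm: "admissible_on_S G \<gamma> U p q"
    and a: "\<And>\<kappa> \<tau> z. \<kappa> \<in> {1, 2} \<Longrightarrow> \<tau> \<in> {1, 2} \<Longrightarrow> z \<in> Sset G p q \<kappa> \<tau> \<Longrightarrow> speed_x \<gamma> (trace G p q U \<kappa> \<tau> z) \<le> a"
    and c: "c \<ge> 0" "l \<ge> 0" "c * lwt G 1 = 2 * l * a"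
  shows "c *\<^sub>R cell_avg G p q U - l *\<^sub>R delta_x G p q (\<lambda>\<kappa> \<tau> z. flux1 \<gamma> (trace G p q U \<kappa> \<tau> z)) \<in> adm_cone"
proof -
  let ?T = "trace G p q U" and ?X = "xlob G p" and ?Y = "ygauss G q"
  have n: "nlob G \<ge> 1" using lob_points by linarith
  have S: "(?X \<kappa> i, ?Y \<tau> j) \<in> Sset G p q \<kappa> \<tau>" if "i \<in> {1..nlob G}" "j \<in> {1..ngauss G}" for \<kappa> \<tau> i j
    using that by (auto simp: Sset_def)
  have T: "?T \<kappa> \<tau> (?X \<kappa> i, ?Y \<tau> j) \<in> admissible \<gamma>"
    if "\<kappa> \<in> {1, 2}" "\<tau> \<in> {1, 2}" "i \<in> {1..nlob G}" "j \<in> {1..ngauss G}" for \<kappa> \<tau> i j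
    using adm S that unfolding admissible_on_S_def by blast
  define P where "P \<tau> j = (\<Sum>i=1..nlob G. lwt G i *\<^sub>R (?T 1 \<tau> (?X 1 i, ?Y \<tau> j) + ?T 2 \<tau> (?X 2 i, ?Y \<tau> j)))" for \<tau> j
  define D where "D \<tau> j = flux1 \<gamma> (?T 2 \<tau> (?X 2 (nlob G), ?Y \<tau> j)) - flux1 \<gamma> (?T 1 \<tau> (?X 1 1, ?Y \<tau> j))" for \<tau> j
  have *: "(c / 4) *\<^sub>R P \<tau> j - (l / 2) *\<^sub>R D \<tau> j \<in> adm_cone"
    if "\<tau> \<in> {1, 2}" "j \<in> {1..ngauss G}" for \<tau> j
    unfolding P_def D_def
  proof (rule two_halves_flux_cone[where a = a])
    show "?T 1 \<tau> (?X 1 i, ?Y \<tau> j) \<in> adm_cone" "?T 2 \<tau> (?X 2 i, ?Y \<tau> j) \<in> adm_cone" if "i \<in> {1..nlob G}" for i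
      using that \<open>\<tau> \<in> {1, 2}\<close> \<open>j \<in> {1..ngauss G}\<close> by (auto intro!: admissible_imp_adm_cone[OF \<gamma>] T)
    show "a *\<^sub>R ?T 1 \<tau> (?X 1 1, ?Y \<tau> j) + flux1 \<gamma> (?T 1 \<tau> (?X 1 1, ?Y \<tau> j)) \<in> adm_cone"
      using that n by (intro flux1_cone[OF \<gamma>] T a S) auto
    show "a *\<^sub>R ?T 2 \<tau> (?X 2 (nlob G), ?Y \<tau> j) - flux1 \<gamma> (?T 2 \<tau> (?X 2 (nlob G), ?Y \<tau> j)) \<in> adm_cone"
      using that n by (intro flux1_cone[OF \<gamma>] T a S) auto
  qed (use c n weights_nonneg(2,3) in auto)
  have mean: "tensor_mean (nlob G) (lwt G) ?X (ngauss G) (gwt G) ?Y ?T =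
      (1 / 4) *\<^sub>R (\<Sum>\<tau>=1..2. \<Sum>j=1..ngauss G. gwt G j *\<^sub>R P \<tau> j)"
    unfolding tensor_mean_swap P_def
    by (simp add: sum_quarters scaleR_right.sum sum.distrib scaleR_add_right mult.commute)
  have delta: "delta_x G p q (\<lambda>\<kappa> \<tau> z. flux1 \<gamma> (?T \<kappa> \<tau> z)) =
      (\<Sum>\<tau>=1..2. \<Sum>j=1..ngauss G. (gwt G j / 2) *\<^sub>R D \<tau> j)"
    unfolding delta_x_def D_def lobatto_endpoints ..
  have eq: "c *\<^sub>R tensor_mean (nlob G) (lwt G) ?X (ngauss G) (gwt G) ?Y ?T - l *\<^sub>R delta_x G p q (\<lambda>\<kappa> \<tau> z. flux1 \<gamma> (?T \<kappa> \<tau> z)) =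
      (\<Sum>\<tau>=1..2. \<Sum>j=1..ngauss G. gwt G j *\<^sub>R ((c / 4) *\<^sub>R P \<tau> j - (l / 2) *\<^sub>R D \<tau> j))"
    unfolding mean delta by (simp add: scaleR_right.sum sum_subtractf scaleR_diff_right mult_ac)
  show ?thesis
    unfolding cell_average_tensor(2)[OF U rules(3) rules(2)] eq
    unfolding halves by (intro adm_cone_sum adm_cone_scaleR * weights_nonneg(1))
qed

lemma flux_y_cone:
  assumes \<gamma>: "\<gamma> > 1" and U: "quarterwise_state p q U" and adm: "admissible_on_S G \<gamma> U p q"
    and a: "\<And>\<kappa> \<tau> z. \<kappa> \<in> {1, 2} \<Longrightarrow> \<tau> \<in> {1, 2} \<Longrightarrow> z \<in> Sset G p q \<kappa> \<tau> \<Longrightarrow> speed_y \<gamma> (trace G p q U \<kappa> \<tau> z) \<le> a"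
    and c: "c \<ge> 0" "l \<ge> 0" "c * lwt G 1 = 2 * l * a"
  shows "c *\<^sub>R cell_avg G p q U - l *\<^sub>R delta_y G p q (\<lambda>\<kappa> \<tau> z. flux2 \<gamma> (trace G p q U \<kappa> \<tau> z)) \<in> adm_cone"
proof -
  let ?T = "trace G p q U" and ?X = "xgauss G p" and ?Y = "ylob G q"
  have n: "nlob G \<ge> 1" using lob_points by linarith
  have S: "(?X \<kappa> i, ?Y \<tau> j) \<in> Sset G p q \<kappa> \<tau>" if "i \<in> {1..ngauss G}" "j \<in> {1..nlob G}" for \<kappa> \<tau> i j
    using that by (auto simp: Sset_def)
  have T: "?T \<kappa> \<tau> (?X \<kappa> i, ?Y \<tau> j) \<in> admissible \<gamma>"
    if "\<kappa> \<in> {1, 2}" "\<tau> \<in> {1, 2}" "i \<in> {1..ngauss G}" "j \<in> {1..nlob G}" for \<kappa> \<tau> i j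
    using adm S that unfolding admissible_on_S_def by blast
  define P where "P \<kappa> i = (\<Sum>j=1..nlob G. lwt G j *\<^sub>R (?T \<kappa> 1 (?X \<kappa> i, ?Y 1 j) + ?T \<kappa> 2 (?X \<kappa> i, ?Y 2 j)))" for \<kappa> i
  define D where "D \<kappa> i = flux2 \<gamma> (?T \<kappa> 2 (?X \<kappa> i, ?Y 2 (nlob G))) - flux2 \<gamma> (?T \<kappa> 1 (?X \<kappa> i, ?Y 1 1))" for \<kappa> i
  have *: "(c / 4) *\<^sub>R P \<kappa> i - (l / 2) *\<^sub>R D \<kappa> i \<in> adm_cone"
    if "\<kappa> \<in> {1, 2}" "i \<in> {1..ngauss G}" for \<kappa> i
    unfolding P_def D_def
  proof (rule two_halves_flux_cone[where a = a])
    show "?T \<kappa> 1 (?X \<kappa> i, ?Y 1 j) \<in> adm_cone" "?T \<kappa> 2 (?X \<kappa> i, ?Y 2 j) \<in> adm_cone" if "j \<in> {1..nlob G}" for j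
      using that \<open>\<kappa> \<in> {1, 2}\<close> \<open>i \<in> {1..ngauss G}\<close> by (auto intro!: admissible_imp_adm_cone[OF \<gamma>] T)
    show "a *\<^sub>R ?T \<kappa> 1 (?X \<kappa> i, ?Y 1 1) + flux2 \<gamma> (?T \<kappa> 1 (?X \<kappa> i, ?Y 1 1)) \<in> adm_cone"
      using that n by (intro flux2_cone[OF \<gamma>] T a S) auto
    show "a *\<^sub>R ?T \<kappa> 2 (?X \<kappa> i, ?Y 2 (nlob G)) - flux2 \<gamma> (?T \<kappa> 2 (?X \<kappa> i, ?Y 2 (nlob G))) \<in> adm_cone"
      using that n by (intro flux2_cone[OF \<gamma>] T a S) auto
  qed (use c n weights_nonneg(2,3) in auto)
  have mean: "tensor_mean (ngauss G) (gwt G) ?X (nlob G) (lwt G) ?Y ?T =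
      (1 / 4) *\<^sub>R (\<Sum>\<kappa>=1..2. \<Sum>i=1..ngauss G. gwt G i *\<^sub>R P \<kappa> i)"
    unfolding tensor_mean_def P_def
    by (simp add: sum_quarters scaleR_right.sum sum.distrib scaleR_add_right mult.commute)
  have delta: "delta_y G p q (\<lambda>\<kappa> \<tau> z. flux2 \<gamma> (?T \<kappa> \<tau> z)) =
      (\<Sum>\<kappa>=1..2. \<Sum>i=1..ngauss G. (gwt G i / 2) *\<^sub>R D \<kappa> i)"
    unfolding delta_y_def D_def lobatto_endpoints ..
  have eq: "c *\<^sub>R tensor_mean (ngauss G) (gwt G) ?X (nlob G) (lwt G) ?Y ?T - l *\<^sub>R delta_y G p q (\<lambda>\<kappa> \<tau> z. flux2 \<gamma> (?T \<kappa> \<tau> z)) =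
      (\<Sum>\<kappa>=1..2. \<Sum>i=1..ngauss G. gwt G i *\<^sub>R ((c / 4) *\<^sub>R P \<kappa> i - (l / 2) *\<^sub>R D \<kappa> i))"
    unfolding mean delta by (simp add: scaleR_right.sum sum_subtractf scaleR_diff_right mult_ac)
  show ?thesis
    unfolding cell_average_tensor(2)[OF U rules(1) rules(4)] eq
    unfolding halves by (intro adm_cone_sum adm_cone_scaleR * weights_nonneg(1))
qed

end

section \<open>The update of one cell\<close>

lemma finite_quarter_values:
  assumes "\<And>\<kappa> \<tau>. finite (A \<kappa> \<tau>)"
  shows "finite {f \<kappa> \<tau> z |\<kappa> \<tau> z. \<kappa> \<in> {1::nat, 2} \<and> \<tau> \<in> {1::nat, 2} \<and> z \<in> A \<kappa> \<tau>}"
  by (rule finite_subset[of _ "\<Union>\<kappa>\<in>{1, 2}. \<Union>\<tau>\<in>{1, 2}. f \<kappa> \<tau> ` A \<kappa> \<tau>"]) (use assms in auto)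

lemma quarter_value_le_Max:
  fixes f :: "nat \<Rightarrow> nat \<Rightarrow> 'b \<Rightarrow> 'a::linorder"
  assumes "\<And>\<kappa> \<tau>. finite (A \<kappa> \<tau>)" "\<kappa> \<in> {1, 2}" "\<tau> \<in> {1, 2}" "z \<in> A \<kappa> \<tau>"
  shows "f \<kappa> \<tau> z \<le> Max {f \<kappa> \<tau> z |\<kappa> \<tau> z. \<kappa> \<in> {1::nat, 2} \<and> \<tau> \<in> {1::nat, 2} \<and> z \<in> A \<kappa> \<tau>}"
  by (rule Max_ge[OF finite_quarter_values]) (use assms in auto)

context staggered_grid
begin

lemma finite_points: "finite (Qset G p q \<kappa> \<tau>)" "finite (Sset G p q \<kappa> \<tau>)"
  by (simp_all add: Sset_def Qset_def)

lemma gauss_point: "i \<in> {1..ngauss G} \<Longrightarrow> j \<in> {1..ngauss G} \<Longrightarrow> (xgauss G p \<kappa> i, ygauss G q \<tau> j) \<in> Qset G p q \<kappa> \<tau>"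
  by (auto simp: Qset_def)

lemma Qset_subset_Sset: "Qset G p q \<kappa> \<tau> \<subseteq> Sset G p q \<kappa> \<tau>"
  by (auto simp: Sset_def)

lemma source_mean_cone:
  assumes \<gamma>: "\<gamma> > 1" and U: "quarterwise_state p q U" and f: "quarterwise_poly p q f"
    and adm: "admissible_on_S G \<gamma> U p q"
  shows "alpha_s G \<gamma> U \<rho> f p q *\<^sub>R cell_avg G p q U + (1 / (dx G * dy G)) *\<^sub>R source G U \<rho> f p q \<in> adm_cone"
proof -
  let ?b = "alpha_s G \<gamma> U \<rho> f p q" and ?T = "trace G p q U" and ?g = "grad_phi_hat G \<rho> f p q"
  have "gauss_mean p q (\<lambda>\<kappa> \<tau> z. ?b *\<^sub>R ?T \<kappa> \<tau> z - Qmat (?T \<kappa> \<tau> z) *v ?g \<kappa> \<tau> z) \<in> adm_cone"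
  proof (rule tensor_mean_adm_cone)
    fix \<kappa> \<tau> i j assume \<kappa>\<tau>: "\<kappa> \<in> {1::nat, 2}" "\<tau> \<in> {1::nat, 2}" and ij: "i \<in> {1..ngauss G}" "j \<in> {1..ngauss G}"
    let ?z = "(xgauss G p \<kappa> i, ygauss G q \<tau> j)"
    show "?b *\<^sub>R ?T \<kappa> \<tau> ?z - Qmat (?T \<kappa> \<tau> ?z) *v ?g \<kappa> \<tau> ?z \<in> adm_cone"
    proof (rule source_cone[OF \<gamma>])
      show "?T \<kappa> \<tau> ?z \<in> admissible \<gamma>"
        using adm \<kappa>\<tau> gauss_point[OF ij] Qset_subset_Sset unfolding admissible_on_S_def by blast
      show "norm (?g \<kappa> \<tau> ?z) * sqrt ((\<gamma> - 1) * ?T \<kappa> \<tau> ?z $ 1 / (2 * pressure \<gamma> (?T \<kappa> \<tau> ?z))) \<le> ?b"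
        unfolding alpha_s_def by (rule quarter_value_le_Max[where A = "Qset G p q", OF finite_points(1) \<kappa>\<tau> gauss_point[OF ij]])
    qed
  qed (use weights_nonneg in auto)
  moreover have "gauss_mean p q (\<lambda>\<kappa> \<tau> z. ?b *\<^sub>R ?T \<kappa> \<tau> z - Qmat (?T \<kappa> \<tau> z) *v ?g \<kappa> \<tau> z) =
    ?b *\<^sub>R gauss_mean p q ?T - gauss_mean p q (\<lambda>\<kappa> \<tau> z. Qmat (?T \<kappa> \<tau> z) *v ?g \<kappa> \<tau> z)"
    by (simp add: tensor_mean_def scaleR_diff_right sum_subtractf scaleR_right.sum mult_ac)
  ultimately show ?thesis
    using dx dy by (simp add: source_eq[OF U f] cell_average_tensor(2)[OF U rules(1,2)])
qed

theorem cell_update_admissible: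
  assumes \<gamma>: "\<gamma> > 1" and U: "quarterwise_state p q U" and f: "quarterwise_poly p q f"
    and adm: "admissible_on_S G \<gamma> U p q" and avg: "cell_avg G p q UA \<in> admissible \<gamma>"
    and dt: "dt > 0" and \<theta>: "dt / \<tau>max \<le> 1"
    and CFL: "dt / dx G * alpha_x G \<gamma> U \<rho> f p q + dt / dy G * alpha_y G \<gamma> U \<rho> f p q < dt / \<tau>max * lwt G 1 / 2"
  shows "cell_avg G p q UA + dt *\<^sub>R Lop G \<gamma> \<tau>max UA U \<rho> f p q \<in> admissible \<gamma>"
proof -
  let ?T = "trace G p q U"
  let ?Fx = "delta_x G p q (\<lambda>\<kappa> \<tau> z. flux1 \<gamma> (?T \<kappa> \<tau> z))" and ?Fy = "delta_y G p q (\<lambda>\<kappa> \<tau> z. flux2 \<gamma> (?T \<kappa> \<tau> z))"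
  define A where "A = cell_avg G p q UA"
  define B where "B = cell_avg G p q U"
  define S where "S = source G U \<rho> f p q"
  define \<theta> where "\<theta> = dt / \<tau>max"
  define w where "w = lwt G 1"
  define \<alpha> where "\<alpha> = alpha_s G \<gamma> U \<rho> f p q"
  define a where "a = Max {speed_x \<gamma> (?T \<kappa> \<tau> z) |\<kappa> \<tau> z. \<kappa> \<in> {1, 2} \<and> \<tau> \<in> {1, 2} \<and> z \<in> Sset G p q \<kappa> \<tau>}"
  define b where "b = Max {speed_y \<gamma> (?T \<kappa> \<tau> z) |\<kappa> \<tau> z. \<kappa> \<in> {1, 2} \<and> \<tau> \<in> {1, 2} \<and> z \<in> Sset G p q \<kappa> \<tau>}"
  have T: "?T \<kappa> \<tau> z \<in> admissible \<gamma>" if "\<kappa> \<in> {1, 2}" "\<tau> \<in> {1, 2}" "z \<in> Sset G p q \<kappa> \<tau>" for \<kappa> \<tau> z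
    using adm that unfolding admissible_on_S_def by blast
  have a: "speed_x \<gamma> (?T \<kappa> \<tau> z) \<le> a" and b: "speed_y \<gamma> (?T \<kappa> \<tau> z) \<le> b"
    if "\<kappa> \<in> {1, 2}" "\<tau> \<in> {1, 2}" "z \<in> Sset G p q \<kappa> \<tau>" for \<kappa> \<tau> z
    unfolding a_def b_def by (rule quarter_value_le_Max[where A = "Sset G p q", OF finite_points(2) that])+

  \<comment> \<open>The maxima are nonnegative because they bound the value at some point; the first Gauss point will do.\<close>
  have one: "1 \<in> {1..ngauss G}" using gauss_points by simp
  let ?z = "(xgauss G p 1 1, ygauss G q 1 1)"
  have zQ: "?z \<in> Qset G p q 1 1" by (rule gauss_point[OF one one])
  then have zS: "?z \<in> Sset G p q 1 1" using Qset_subset_Sset by blast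
  have Tz: "?T 1 1 ?z $ 1 > 0" "pressure \<gamma> (?T 1 1 ?z) > 0"
    using T[OF _ _ zS] by (auto simp: admissible_def)
  have "0 \<le> speed_x \<gamma> (?T 1 1 ?z)" "0 \<le> speed_y \<gamma> (?T 1 1 ?z)"
    using Tz \<gamma> by (simp_all add: speed_x_def speed_y_def)
  then have a0: "a \<ge> 0" and b0: "b \<ge> 0" using a[OF _ _ zS] b[OF _ _ zS] by fastforce+
  have "0 \<le> norm (grad_phi_hat G \<rho> f p q 1 1 ?z) *
      sqrt ((\<gamma> - 1) * ?T 1 1 ?z $ 1 / (2 * pressure \<gamma> (?T 1 1 ?z)))"
    using Tz \<gamma> by simp
  also have "\<dots> \<le> \<alpha>" unfolding \<alpha>_def alpha_s_def by (rule quarter_value_le_Max[where A = "Qset G p q", OF finite_points(1) _ _ zQ]) auto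
  finally have \<alpha>0: "\<alpha> \<ge> 0" .
  have w0: "w \<ge> 0" using weights_nonneg(2)[of 1] lob_points by (simp add: w_def)

  define \<theta>x where "\<theta>x = 2 * (dt / dx G) * a / w"
  define \<theta>y where "\<theta>y = 2 * (dt / dy G) * b / w"
  have "dt / dx G * (a + w * dx G / 4 * \<alpha>) + dt / dy G * (b + w * dy G / 4 * \<alpha>) < \<theta> * w / 2"
    using CFL by (simp add: alpha_x_def alpha_y_def a_def b_def \<alpha>_def w_def \<theta>_def)
  moreover have "dt / dx G * (a + w * dx G / 4 * \<alpha>) + dt / dy G * (b + w * dy G / 4 * \<alpha>) =
      dt / dx G * a + dt / dy G * b + dt * \<alpha> * w / 2"
    using dx dy by (simp add: field_simps)
  ultimately have cfl: "dt / dx G * a + dt / dy G * b + dt * \<alpha> * w / 2 < \<theta> * w / 2" by simp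
  moreover have "0 \<le> dt / dx G * a + dt / dy G * b + dt * \<alpha> * w / 2"
    using dt dx dy a0 b0 \<alpha>0 w0 by (intro add_nonneg_nonneg) auto
  \<comment> \<open>The left-hand side of the CFL condition is nonnegative, hence its right-hand side is positive.\<close>
  ultimately have "\<theta> * w \<noteq> 0" by linarith
  then have w: "w > 0" using w0 by (auto simp: less_le)
  have "(\<theta>x + \<theta>y + dt * \<alpha>) * w / 2 < \<theta> * w / 2"
    using cfl w by (simp add: \<theta>x_def \<theta>y_def field_simps)
  then have rest: "\<theta> - \<theta>x - \<theta>y - dt * \<alpha> > 0" using w by (simp add: mult_less_cancel_right)

  have "B \<in> admissible \<gamma>"
    unfolding B_def cell_average_tensor(2)[OF U rules(1,2)]
  proof (rule tensor_mean_admissible[OF \<gamma>])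
    show "sum (gwt G) {1..ngauss G} = 1" "sum (gwt G) {1..ngauss G} = 1"
      using composite_rule_weights_sum[OF rules(1)] dx by auto
    show "?T \<kappa> \<tau> (xgauss G p \<kappa> i, ygauss G q \<tau> j) \<in> admissible \<gamma>"
      if "\<kappa> \<in> {1, 2}" "\<tau> \<in> {1, 2}" "i \<in> {1..ngauss G}" "j \<in> {1..ngauss G}" for \<kappa> \<tau> i j
      using T[OF that(1,2)] gauss_point[OF that(3,4)] Qset_subset_Sset by blast
  qed (use weights_nonneg in auto)
  then have "(\<theta> - \<theta>x - \<theta>y - dt * \<alpha>) *\<^sub>R B \<in> admissible \<gamma>"
    by (rule admissible_scaleR[OF \<gamma> _ rest])
  moreover have "(1 - \<theta>) *\<^sub>R A \<in> adm_cone"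
    using admissible_imp_adm_cone[OF \<gamma> avg] \<open>dt / \<tau>max \<le> 1\<close> unfolding A_def \<theta>_def by (intro adm_cone_scaleR) auto
  moreover have "\<theta>x *\<^sub>R B - (dt / dx G) *\<^sub>R ?Fx \<in> adm_cone"
    unfolding B_def by (rule flux_x_cone[OF \<gamma> U adm a]) (use dt dx a0 w in \<open>auto simp: \<theta>x_def w_def\<close>)
  moreover have "\<theta>y *\<^sub>R B - (dt / dy G) *\<^sub>R ?Fy \<in> adm_cone"
    unfolding B_def by (rule flux_y_cone[OF \<gamma> U adm b]) (use dt dy b0 w in \<open>auto simp: \<theta>y_def w_def\<close>)
  moreover have "dt *\<^sub>R (\<alpha> *\<^sub>R B + (1 / (dx G * dy G)) *\<^sub>R S) \<in> adm_cone"
    using source_mean_cone[OF \<gamma> U f adm] dt unfolding B_def \<alpha>_def S_def by (intro adm_cone_scaleR) auto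
  ultimately have "(\<theta> - \<theta>x - \<theta>y - dt * \<alpha>) *\<^sub>R B + ((1 - \<theta>) *\<^sub>R A + (\<theta>x *\<^sub>R B - (dt / dx G) *\<^sub>R ?Fx) +
      (\<theta>y *\<^sub>R B - (dt / dy G) *\<^sub>R ?Fy) + dt *\<^sub>R (\<alpha> *\<^sub>R B + (1 / (dx G * dy G)) *\<^sub>R S)) \<in> admissible \<gamma>"
    by (intro admissible_add_cone[OF \<gamma>] adm_cone_add)
  moreover have "A + dt *\<^sub>R Lop G \<gamma> \<tau>max UA U \<rho> f p q =
      (\<theta> - \<theta>x - \<theta>y - dt * \<alpha>) *\<^sub>R B + ((1 - \<theta>) *\<^sub>R A + (\<theta>x *\<^sub>R B - (dt / dx G) *\<^sub>R ?Fx) +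
      (\<theta>y *\<^sub>R B - (dt / dy G) *\<^sub>R ?Fy) + dt *\<^sub>R (\<alpha> *\<^sub>R B + (1 / (dx G * dy G)) *\<^sub>R S))"
    unfolding Lop_def A_def[symmetric] B_def[symmetric] S_def[symmetric] \<theta>_def
    by (simp add: algebra_simps)
  ultimately show ?thesis unfolding A_def by simp
qed

end

theorem theorem4p2:
  fixes G :: grid and k :: nat and \<gamma> dt \<tau>max \<theta> \<alpha>x \<alpha>y :: real
    and C D :: "(int \<times> int) set"
    and \<Omega> :: "(real \<times> real) set"
    and \<phi> \<rho>s ps :: "real \<times> real \<Rightarrow> real"
    and UC UD UsC UsD :: "real \<times> real \<Rightarrow> real ^ 4"
    and \<rho>sC \<rho>sD psC psD :: "real \<times> real \<Rightarrow> real"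
  assumes gamma: "\<gamma> > 1"
    and degree: "k \<ge> 2"
    and steps: "dx G > 0" "dy G > 0" "dt > 0" "\<tau>max > 0"
    and gauss: "ngauss G \<ge> k + 1" "gauss_rule (ngauss G) (gnode G) (gwt G)"
    and lobatto: "nlob G = nat \<lceil>(real k + 3) / 2\<rceil>" "gauss_lobatto_rule (nlob G) (lnode G) (lwt G)"
    and meshes: "primal_mesh C" "dual_mesh D"
    and domain: "open \<Omega>" "\<And>p q. (p, q) \<in> C \<union> D \<Longrightarrow> cell G p q \<subseteq> \<Omega>"
    and stationary: "hydrostatic \<Omega> \<phi> \<rho>s ps"
    and integrable: "\<And>p q. (p, q) \<in> C \<union> D \<Longrightarrow> \<rho>s absolutely_integrable_on cell G p q"
      "\<And>p q. (p, q) \<in> C \<union> D \<Longrightarrow> ps absolutely_integrable_on cell G p q"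
    and proj_state:
      "\<And>i. is_proj G k C (\<lambda>z. hydrostatic_state \<gamma> \<rho>s ps z $ i) (\<lambda>z. UsC z $ i)"
      "\<And>i. is_proj G k D (\<lambda>z. hydrostatic_state \<gamma> \<rho>s ps z $ i) (\<lambda>z. UsD z $ i)"
    and proj_density: "is_proj G k C \<rho>s \<rho>sC" "is_proj G k D \<rho>s \<rho>sD"
    and proj_pressure: "is_proj G k C ps psC" "is_proj G k D ps psD"
    and solutions: "UC \<in> Vh4 G k C" "UD \<in> Vh4 G k D"
    and solution_adm:
      "\<And>p q. (p, q) \<in> C \<Longrightarrow> admissible_on_S G \<gamma> UC p q"
      "\<And>p q. (p, q) \<in> D \<Longrightarrow> admissible_on_S G \<gamma> UD p q"
    and stationary_adm:
      "\<And>p q. (p, q) \<in> C \<Longrightarrow> admissible_on_S G \<gamma> UsC p q"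
      "\<And>p q. (p, q) \<in> D \<Longrightarrow> admissible_on_S G \<gamma> UsD p q"
    and average_adm:
      "\<And>p q. (p, q) \<in> C \<Longrightarrow> cell_avg G p q UC \<in> admissible \<gamma>"
      "\<And>p q. (p, q) \<in> D \<Longrightarrow> cell_avg G p q UD \<in> admissible \<gamma>"
    and alpha_x_def:
      "\<alpha>x = Max ((\<lambda>(p, q). alpha_x G \<gamma> UD \<rho>sD psD p q) ` covered C D \<union>
                 (\<lambda>(p, q). alpha_x G \<gamma> UC \<rho>sC psC p q) ` covered D C)"
    and alpha_y_def:
      "\<alpha>y = Max ((\<lambda>(p, q). alpha_y G \<gamma> UD \<rho>sD psD p q) ` covered C D \<union>
                 (\<lambda>(p, q). alpha_y G \<gamma> UC \<rho>sC psC p q) ` covered D C)"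
    and theta: "\<theta> = dt / \<tau>max" "0 < \<theta>" "\<theta> \<le> 1"
    and CFL: "dt / dx G * \<alpha>x + dt / dy G * \<alpha>y < \<theta> * lwt G 1 / 2"
  shows "(\<forall>(p, q)\<in>covered C D.
            cell_avg G p q UC + dt *\<^sub>R Lop G \<gamma> \<tau>max UC UD \<rho>sD psD p q \<in> admissible \<gamma>) \<and>
         (\<forall>(p, q)\<in>covered D C.
            cell_avg G p q UD + dt *\<^sub>R Lop G \<gamma> \<tau>max UD UC \<rho>sC psC p q \<in> admissible \<gamma>)"
proof -
  \<comment> \<open>\<open>L = \<lceil>(k + 3) / 2\<rceil>\<close> gives the required exactness \<open>2 L - 3 \<ge> k\<close>.\<close>
  have "(real k + 3) / 2 \<le> real (nlob G)"
    unfolding lobatto(1) by linarith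
  then have "real (k + 3) \<le> real (2 * nlob G)" by simp
  then have "k + 3 \<le> 2 * nlob G" by (simp only: of_nat_le_iff)
  then interpret staggered_grid G k
    using steps gauss lobatto(2) by unfold_locales auto
  have cover: "finite (covered M M')" if "finite M" for M M' :: "(int \<times> int) set"
    using that by (rule finite_subset[rotated]) (auto simp: covered_def)
  have fin: "finite (covered C D)" "finite (covered D C)"
    using meshes cover by (auto simp: primal_mesh_def dual_mesh_def)
  have speeds_D: "alpha_x G \<gamma> UD \<rho>sD psD p q \<le> \<alpha>x" "alpha_y G \<gamma> UD \<rho>sD psD p q \<le> \<alpha>y"
    if "(p, q) \<in> covered C D" for p q
    unfolding alpha_x_def alpha_y_def using fin that by (auto intro!: Max_ge)
  have speeds_C: "alpha_x G \<gamma> UC \<rho>sC psC p q \<le> \<alpha>x" "alpha_y G \<gamma> UC \<rho>sC psC p q \<le> \<alpha>y"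
    if "(p, q) \<in> covered D C" for p q
    unfolding alpha_x_def alpha_y_def using fin that by (auto intro!: Max_ge)
  have cell_CFL: "dt / dx G * s + dt / dy G * t < dt / \<tau>max * lwt G 1 / 2" if "s \<le> \<alpha>x" "t \<le> \<alpha>y" for s t
  proof -
    have "dt / dx G * s + dt / dy G * t \<le> dt / dx G * \<alpha>x + dt / dy G * \<alpha>y"
      using that steps by (intro add_mono mult_left_mono) auto
    then show ?thesis using CFL theta(1) by simp
  qed
  have poly: "quarterwise_state p q U" if "U \<in> Vh4 G k M'" "(p, q) \<in> covered M M'" for U M M' p q
    using that by (auto simp: quarterwise_state_def Vh4_def intro: quarterwise_poly_Vh)
  have pressure: "psC \<in> Vh G k C" "psD \<in> Vh G k D"
    using proj_pressure by (auto simp: is_proj_def)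
  have primal: "cell_avg G p q UC + dt *\<^sub>R Lop G \<gamma> \<tau>max UC UD \<rho>sD psD p q \<in> admissible \<gamma>"
    if pq: "(p, q) \<in> covered C D" for p q
  proof (rule cell_update_admissible[OF gamma])
    show "admissible_on_S G \<gamma> UD p q" by (rule admissible_on_S_covered[OF solution_adm(2) pq])
    show "cell_avg G p q UC \<in> admissible \<gamma>" using pq by (intro average_adm) (auto simp: covered_def)
  qed (use poly[OF solutions(2) pq] quarterwise_poly_Vh[OF pressure(2) pq] steps theta
      cell_CFL[OF speeds_D[OF pq]] in auto)
  have dual: "cell_avg G p q UD + dt *\<^sub>R Lop G \<gamma> \<tau>max UD UC \<rho>sC psC p q \<in> admissible \<gamma>"
    if pq: "(p, q) \<in> covered D C" for p q
  proof (rule cell_update_admissible[OF gamma])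
    show "admissible_on_S G \<gamma> UC p q" by (rule admissible_on_S_covered[OF solution_adm(1) pq])
    show "cell_avg G p q UD \<in> admissible \<gamma>" using pq by (intro average_adm) (auto simp: covered_def)
  qed (use poly[OF solutions(1) pq] quarterwise_poly_Vh[OF pressure(1) pq] steps theta
      cell_CFL[OF speeds_C[OF pq]] in auto)
  from primal dual show ?thesis by blast
qed

end
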